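(* For each finite group $G$ there exist a natural number $d$ and a convex polytope $P_G$ in $\mathbb{R}^d$ satisfying all of the following properties: (i) the group of combinatorial automorphisms of $P_G$ is isomorphic to $G$; (ii) any combinatorial automorphism of $P_G$ is the restriction to the set of vertices of $P_G$ of some isometry of $P_G$; (iii) the convex polytope $P_G$ is binary, and even combinatorial; (iv) the diameter of the skeleton of $P_G$ is at most $2$; (v) any automorphism of the skeleton of $P_G$ is a combinatorial automorphism of $P_G$.
   Context: $\mathbb{R}^d$ is regarded as a Euclidean vector space with the usual dot product. A convex polytope is the convex hull of a finite nonempty set of points. A combinatorial automorphism of a convex polytope is a permutation of its set of vertices that maps the set of vertices of any face to the set of vertices of some face. The isometries of $\mathbb{R}^d$ are the permutations of $\mathbb{R}^d$ that preserve distance; for a subset $P$ of $\mathbb{R}^d$, the isometries of $P$ are the isometries of $\mathbb{R}^d$ that stabilize $P$ (map $P$ onto $P$). A convex polytope is binary if all its vertices have all coordinates equal to $0$ or $1$. A convex polytope is combinatorial if it is binary and, for every two (distinct) nonadjacent vertices, their midpoint equals the midpoint of two other vertices. The skeleton (or graph) of a polytope is the graph whose nodes are the vertices of the polytope, two vertices being adjacent when they are the endpoints of an edge (1-dimensional face) of the polytope. An automorphism of the skeleton is a graph automorphism of it, viewed as a permutation of the set of vertices of the polytope. *)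

theory Defs
  imports
    "HOL-Analysis.Analysis"
    "HOL-Algebra.Bij"
    "HOL-Library.Function_Algebras"
    "HOL-Library.Extended_Nat"
begin

text \<open>
  The dimension is quantified inside the statement, so it cannot be a type. As in
  \<^theory>\<open>HOL-Analysis.Abstract_Euclidean_Space\<close>, the space of dimension \<open>d\<close> is the set of
  real sequences vanishing from index \<open>d\<close> on. The pointwise vector space structure below makes the
  library notions \<^const>\<open>convex\<close>, \<^const>\<open>midpoint\<close>, faces and extreme points available for it.
\<close>

instantiation "fun" :: (type, real_vector) real_vector
begin

definition scaleR_fun :: "real \<Rightarrow> ('a \<Rightarrow> 'b) \<Rightarrow> 'a \<Rightarrow> 'b"
  where "scaleR_fun c f = (\<lambda>x. c *\<^sub>R f x)"

instance
  by standard (simp_all add: scaleR_fun_def fun_eq_iff scaleR_add_right scaleR_add_left)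

end

lemma scaleR_fun_apply [simp]: "(c *\<^sub>R f) x = c *\<^sub>R f x"
  by (simp add: scaleR_fun_def)

definition euclid :: "nat \<Rightarrow> (nat \<Rightarrow> real) set"
  where "euclid d = {x. \<forall>i\<ge>d. x i = 0}"

lemma euclid_eq_topspace: "euclid d = topspace (Euclidean_space d)"
  by (simp add: euclid_def topspace_Euclidean_space)

text \<open>
  The distance induced by the dot product. It is not \<^const>\<open>dist\<close>, which on sequences is a metric for
  the product topology.
\<close>

definition euclid_dist :: "nat \<Rightarrow> (nat \<Rightarrow> real) \<Rightarrow> (nat \<Rightarrow> real) \<Rightarrow> real"
  where "euclid_dist d x y = L2_set (\<lambda>i. x i - y i) {..<d}"

definition isometries :: "nat \<Rightarrow> ((nat \<Rightarrow> real) \<Rightarrow> (nat \<Rightarrow> real)) set"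
  where "isometries d =
    {g \<in> Bij (euclid d). \<forall>x\<in>euclid d. \<forall>y\<in>euclid d. euclid_dist d (g x) (g y) = euclid_dist d x y}"

definition isometries_of :: "nat \<Rightarrow> (nat \<Rightarrow> real) set \<Rightarrow> ((nat \<Rightarrow> real) \<Rightarrow> (nat \<Rightarrow> real)) set"
  where "isometries_of d P = {g \<in> isometries d. g ` P = P}"

definition convex_polytope_in :: "nat \<Rightarrow> (nat \<Rightarrow> real) set \<Rightarrow> bool"
  where "convex_polytope_in d P \<longleftrightarrow>
    (\<exists>S. finite S \<and> S \<noteq> {} \<and> S \<subseteq> euclid d \<and> P = convex hull S)"

definition vertices :: "'a::real_vector set \<Rightarrow> 'a set"
  where "vertices P = {v. v extreme_point_of P}"

text \<open>
  The library's \<^const>\<open>aff_dim\<close> and \<open>edge_of\<close> are restricted to \<^class>\<open>euclidean_space\<close>. The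
  condition on \<open>e\<close> is what \<^prop>\<open>aff_dim e = 1\<close> unfolds to: the affine hull of \<open>e\<close> has an affinely
  independent generating set with two elements.
\<close>

definition edge :: "'a::real_vector set \<Rightarrow> 'a set \<Rightarrow> bool"
  where "edge e P \<longleftrightarrow> e face_of P \<and>
    (\<exists>B. affine hull B = affine hull e \<and> \<not> affine_dependent B \<and> card B = 2)"

definition adjacent :: "'a::real_vector set \<Rightarrow> 'a \<Rightarrow> 'a \<Rightarrow> bool"
  where "adjacent P u v \<longleftrightarrow> u \<noteq> v \<and> (\<exists>e. edge e P \<and> e = closed_segment u v)"

lemma adjacent_iff: "adjacent P u v \<longleftrightarrow> u \<noteq> v \<and> closed_segment u v face_of P"
proof -
  have "\<exists>B. affine hull B = affine hull (closed_segment u v) \<and> \<not> affine_dependent B \<and> card B = 2"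
    if "u \<noteq> v"
    using that
    by (intro exI[of _ "{u, v}"])
       (simp add: segment_convex_hull affine_hull_convex_hull affine_independent_2)
  then show ?thesis
    by (auto simp: adjacent_def edge_def)
qed

lemma endpoint_extreme_point_of_segment:
  fixes u v :: "'a::real_vector"
  shows "u extreme_point_of closed_segment u v"
proof -
  have False if a: "a \<in> closed_segment u v" and b: "b \<in> closed_segment u v"
    and u: "u \<in> open_segment a b" for a b
  proof -
    obtain s where s: "0 \<le> s" "a = u + s *\<^sub>R (v - u)"
      using a by (auto simp: closed_segment_def algebra_simps)
    obtain t where t: "0 \<le> t" "b = u + t *\<^sub>R (v - u)"
      using b by (auto simp: closed_segment_def algebra_simps)
    obtain c where c: "a \<noteq> b" "0 < c" "c < 1" "u = (1 - c) *\<^sub>R a + c *\<^sub>R b"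
      using u by (auto simp: in_segment)
    have "((1 - c) * s + c * t) *\<^sub>R (v - u) = 0"
      using c(4) unfolding s(2) t(2) by (simp add: algebra_simps)
    moreover have "v \<noteq> u"
      using c(1) s(2) t(2) by auto
    ultimately have "(1 - c) * s + c * t = 0"
      by simp
    then have "s = 0" "t = 0"
      using c(2,3) s(1) t(1) by (auto simp: add_nonneg_eq_0_iff)
    then show False
      using c(1) s(2) t(2) by simp
  qed
  then show ?thesis
    by (auto simp: extreme_point_of_def)
qed

lemma adjacent_vertices:
  assumes "adjacent P u v"
  shows "u \<in> vertices P" and "v \<in> vertices P"
proof -
  have f: "closed_segment u v face_of P"
    using assms by (simp add: adjacent_iff)
  have "u extreme_point_of closed_segment u v" "v extreme_point_of closed_segment u v"
    using endpoint_extreme_point_of_segment[of u v] endpoint_extreme_point_of_segment[of v u]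
    by (simp_all add: closed_segment_commute)
  then show "u \<in> vertices P" "v \<in> vertices P"
    using extreme_point_of_face[OF f] by (auto simp: vertices_def)
qed

definition comb_auts :: "'a::real_vector set \<Rightarrow> ('a \<Rightarrow> 'a) set"
  where "comb_auts P = {f \<in> Bij (vertices P).
    \<forall>F. F face_of P \<longrightarrow> (\<exists>F'. F' face_of P \<and> f ` vertices F = vertices F')}"

definition comb_aut_group :: "'a::real_vector set \<Rightarrow> ('a \<Rightarrow> 'a) monoid"
  where "comb_aut_group P = BijGroup (vertices P)\<lparr>carrier := comb_auts P\<rparr>"

definition skeleton_auts :: "'a::real_vector set \<Rightarrow> ('a \<Rightarrow> 'a) set"
  where "skeleton_auts P = {f \<in> Bij (vertices P).
    \<forall>u\<in>vertices P. \<forall>v\<in>vertices P. adjacent P (f u) (f v) \<longleftrightarrow> adjacent P u v}"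

text \<open>Distance and diameter are infinite for pairs of vertices not joined by a walk.\<close>

definition skeleton_dist :: "'a::real_vector set \<Rightarrow> 'a \<Rightarrow> 'a \<Rightarrow> enat"
  where "skeleton_dist P u v = (INF k\<in>{k. (adjacent P ^^ k) u v}. enat k)"

definition skeleton_diameter :: "'a::real_vector set \<Rightarrow> enat"
  where "skeleton_diameter P = (SUP u\<in>vertices P. SUP v\<in>vertices P. skeleton_dist P u v)"

definition binary_polytope :: "nat \<Rightarrow> (nat \<Rightarrow> real) set \<Rightarrow> bool"
  where "binary_polytope d P \<longleftrightarrow> (\<forall>v\<in>vertices P. \<forall>i<d. v i = 0 \<or> v i = 1)"

definition combinatorial_polytope :: "nat \<Rightarrow> (nat \<Rightarrow> real) set \<Rightarrow> bool"
  where "combinatorial_polytope d P \<longleftrightarrow> binary_polytope d P \<and>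
    (\<forall>u\<in>vertices P. \<forall>v\<in>vertices P. u \<noteq> v \<and> \<not> adjacent P u v \<longrightarrow>
      (\<exists>w\<in>vertices P - {u, v}. \<exists>x\<in>vertices P - {u, v}. w \<noteq> x \<and> midpoint u v = midpoint w x))"

end

theory Submission
  imports Defs
begin

text \<open>
  To a finite graph on the nodes \<open>0, \<dots>, d - 1\<close> belongs the polytope spanned by the origin, the unit
  vectors \<open>e\<^sub>u\<close> and the sums \<open>e\<^sub>u + e\<^sub>v\<close> over the edges \<open>uv\<close>. Two of its vertices fail to be adjacent
  only for an evident reason: their sum is also the sum of two other vertices. The coincidences are
  \<open>0 + (e\<^sub>u + e\<^sub>v) = e\<^sub>u + e\<^sub>v\<close> for an edge \<open>uv\<close>, \<open>e\<^sub>w + (e\<^sub>u + e\<^sub>v) = (e\<^sub>w + e\<^sub>u) + e\<^sub>v\<close> for a path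
  \<open>wuv\<close>, and \<open>(e\<^sub>u + e\<^sub>v) + (e\<^sub>w + e\<^sub>x) = (e\<^sub>u + e\<^sub>w) + (e\<^sub>v + e\<^sub>x)\<close> for a 4-cycle; for every other pair
  a linear functional is maximal exactly on its segment (\<open>adj_or_opposite\<close>). So the polytope is
  combinatorial, and since in each coincidence a vertex of the second pair is adjacent to both
  vertices of the first, the skeleton has diameter at most 2.

  Automorphisms of the graph act on the polytope by permuting coordinates, hence by isometries.
  Conversely, the skeleton remembers the graph when the graph is sparse enough. The origin has
  exactly \<open>d\<close> neighbours, namely the \<open>e\<^sub>u\<close>; every other vertex has more, because some edge of the graph
  lies far away from it. Thus a skeleton automorphism fixes the origin and permutes the \<open>e\<^sub>u\<close>, and it
  respects the graph because \<open>e\<^sub>u\<close> and \<open>e\<^sub>v\<close> are nonadjacent exactly for an edge \<open>uv\<close>. The vertex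
  \<open>e\<^sub>u + e\<^sub>v\<close> is then located by the set of all \<open>w\<close> for which \<open>e\<^sub>w\<close> is not adjacent to it, provided
  that these sets separate the edges (locale \<open>skeleton_rigid_graph\<close>). Combinatorial automorphisms
  always preserve the skeleton, so the automorphisms of the skeleton, of the face structure and of
  the graph all agree.

  It remains to realise the group by such a graph (\<open>ex_group_graph\<close>). With \<open>r = |G| - 1\<close> and
  \<open>m = 4 r\<close>, put a copy of \<open>G\<close> on each of \<open>m\<close> layers and join \<open>(g, i)\<close> to \<open>(g, j)\<close> when \<open>i \<noteq> j\<close> and
  \<open>i + j \<ge> m - 1\<close>. In this half graph layer \<open>i\<close> would have degree \<open>i + 1\<close>, were it not that on the
  upper half of the layers the condition also holds for \<open>j = i\<close>, so that one neighbour is lost. Each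
  of these \<open>2 r\<close> layers regains it from one further edge, which carries a label: the layers are
  taken in pairs, one pair for each \<open>h \<noteq> 1\<close> in \<open>G\<close>, and \<open>(g, i)\<close> is joined to \<open>(g h, i + 1)\<close>. So
  degrees reveal layers. The plain edges force an automorphism to act in the same way on all layers,
  the labelled edges make this action commute with right multiplications, and therefore it is a left
  translation (\<open>automorphism_is_translation\<close>). A pendant leaf attached to every node supplies the
  sparseness and the separation of edges asked for above.
\<close>

section \<open>Faces of polytopes in a real vector space\<close>

text \<open>
  A point where the functional is maximal can only be a combination of points where it is maximal.
\<close>
lemma face_of_convex_hull_max:
  fixes l :: "'a::real_vector \<Rightarrow> real"
  assumes l: "linear l" and W: "finite W" and le: "\<And>w. w \<in> W \<Longrightarrow> l w \<le> c"
  shows "convex hull {w \<in> W. l w = c} face_of convex hull W" (is "?F face_of _")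
proof -
  have affine: "l ((1 - t) *\<^sub>R a + t *\<^sub>R b) = (1 - t) * l a + t * l b" for a b t
    by (simp add: linear_add[OF l] linear_cmul[OF l])
  have cvx: "convex {x. l x \<le> c}"
    by (auto simp: convex_alt affine intro: convex_bound_le)
  have hull_le: "l x \<le> c" if "x \<in> convex hull W" for x
    using hull_minimal[of W "{x. l x \<le> c}" convex] le cvx that by auto
  have cvx_eq: "convex {x. l x = c}"
    by (auto simp: convex_alt affine) (simp add: algebra_simps)
  have F_eq: "l x = c" if "x \<in> ?F" for x
    using hull_minimal[of "{w \<in> W. l w = c}" "{x. l x = c}" convex] cvx_eq that by auto
  have F_mem: "x \<in> ?F" if x: "x \<in> convex hull W" and lx: "l x = c" for x
  proof -
    obtain u where u: "\<And>w. w \<in> W \<Longrightarrow> 0 \<le> u w" "sum u W = 1" "(\<Sum>w\<in>W. u w *\<^sub>R w) = x"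
      using x by (auto simp: convex_hull_finite[OF W])
    have "(\<Sum>w\<in>W. u w * (c - l w)) = c * sum u W - l x"
      by (simp add: u(3)[symmetric] linear_sum[OF l] linear_cmul[OF l] algebra_simps
          sum_subtractf sum_distrib_left)
    then have "(\<Sum>w\<in>W. u w * (c - l w)) = 0"
      using u(2) lx by simp
    then have "\<forall>w\<in>W. u w * (c - l w) = 0"
      using W u(1) le by (subst (asm) sum_nonneg_eq_0_iff) (auto simp: mult_nonneg_nonneg)
    then have zero: "l w = c" if "w \<in> W" "u w \<noteq> 0" for w
      using that by auto
    have "sum u {w \<in> W. l w = c} = sum u W"
      "(\<Sum>w\<in>{w \<in> W. l w = c}. u w *\<^sub>R w) = (\<Sum>w\<in>W. u w *\<^sub>R w)"
      using zero by (auto intro!: sum.mono_neutral_left[OF W])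
    then have "sum u {w \<in> W. l w = c} = 1" "(\<Sum>w\<in>{w \<in> W. l w = c}. u w *\<^sub>R w) = x"
      by (simp_all only: u(2,3))
    then show ?thesis
      using W u(1) by (auto simp: convex_hull_finite)
  qed
  have "a \<in> ?F \<and> b \<in> ?F"
    if ab: "a \<in> convex hull W" "b \<in> convex hull W" and x: "x \<in> ?F" "x \<in> open_segment a b" for a b x
  proof -
    obtain t where t: "0 < t" "t < 1" "x = (1 - t) *\<^sub>R a + t *\<^sub>R b"
      using x(2) by (auto simp: in_segment)
    have "(1 - t) * (c - l a) + t * (c - l b) = c - ((1 - t) * l a + t * l b)"
      by (simp add: algebra_simps)
    also have "\<dots> = 0"
      using F_eq[OF x(1)] unfolding t(3) affine by simp
    finally have "(1 - t) * (c - l a) = 0" "t * (c - l b) = 0"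
      using t hull_le[OF ab(1)] hull_le[OF ab(2)]
      by (simp_all add: add_nonneg_eq_0_iff)
    then show ?thesis
      using t F_mem ab by auto
  qed
  moreover have "?F \<subseteq> convex hull W"
    by (intro hull_mono) auto
  ultimately show ?thesis
    unfolding face_of_def by (intro conjI ballI impI convex_convex_hull) blast+
qed

text \<open>
  A generator of positive weight in a combination lies on a segment through the combined point, so it
  belongs to every face containing that point.
\<close>
lemma face_of_convex_hull_eq_hull_generators:
  fixes W :: "'a::real_vector set"
  assumes W: "finite W" and F: "F face_of convex hull W"
  shows "F = convex hull (F \<inter> W)"
proof
  show "convex hull (F \<inter> W) \<subseteq> F"
    using F by (intro hull_minimal) (auto simp: face_of_def)
  show "F \<subseteq> convex hull (F \<inter> W)"
  proof
    fix x assume x: "x \<in> F"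
    then have "x \<in> convex hull W"
      using F by (auto simp: face_of_def)
    then obtain u where u: "\<And>w. w \<in> W \<Longrightarrow> 0 \<le> u w" "sum u W = 1" "(\<Sum>w\<in>W. u w *\<^sub>R w) = x"
      by (auto simp: convex_hull_finite[OF W])
    have supp: "w \<in> F" if w: "w \<in> W" "u w \<noteq> 0" for w
      (* In the generic case x lies strictly between w and the normalised rest y. *)
    proof (cases "u w = 1")
      case True
      then have "sum u (W - {w}) = 0"
        using W w u(2) by (simp add: sum_diff1)
      then have "u v = 0" if "v \<in> W - {w}" for v
        using W u(1) that by (subst (asm) sum_nonneg_eq_0_iff) auto
      then have "(\<Sum>v\<in>W - {w}. u v *\<^sub>R v) = 0"
        by (intro sum.neutral) auto
      then have "x = w"
        using W w u(3) True by (simp add: sum.remove[of W w])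
      then show ?thesis using x by simp
    next
      case False
      define y where "y = (\<Sum>v\<in>W - {w}. (u v / (1 - u w)) *\<^sub>R v)"
      have rest: "sum u (W - {w}) = 1 - u w"
        using W w u(2) by (simp add: sum_diff1)
      have "0 \<le> sum u (W - {w})"
        using u(1) by (intro sum_nonneg) auto
      then have lt: "0 < u w" "u w < 1"
        using rest False w u(1)[of w] by auto
      have "(\<Sum>v\<in>W - {w}. u v / (1 - u w)) = 1"
        using rest lt by (simp flip: sum_divide_distrib)
      then have "y \<in> convex hull (W - {w})"
        unfolding y_def using W u(1) lt
        by (intro convex_sum) (auto intro: hull_inc)
      then have y: "y \<in> convex hull W"
        using hull_mono[of "W - {w}" W] by blast
      have xy: "x = (1 - u w) *\<^sub>R y + u w *\<^sub>R w"
        using W w lt by (simp add: y_def scaleR_sum_right sum.remove[of W w] add.commute flip: u(3))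
      show ?thesis
      proof (cases "w = y")
        case True
        then show ?thesis using xy x by (simp add: algebra_simps)
      next
        case False
        then have "x \<in> open_segment y w"
          using lt xy by (auto simp: in_segment)
        then show ?thesis
          using F x y w by (auto simp: face_of_def intro: hull_inc)
      qed
    qed
    have "sum u (F \<inter> W) = sum u W" "(\<Sum>w\<in>F \<inter> W. u w *\<^sub>R w) = (\<Sum>w\<in>W. u w *\<^sub>R w)"
      using supp by (auto intro!: sum.mono_neutral_left[OF W])
    then have "sum u (F \<inter> W) = 1" "(\<Sum>w\<in>F \<inter> W. u w *\<^sub>R w) = x"
      by (simp_all only: u(2,3))
    then show "x \<in> convex hull (F \<inter> W)"
      using W u(1) by (auto simp: convex_hull_finite)
  qed
qed

lemma vertices_closed_segment: "vertices (closed_segment u v) = {u, v}"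
proof
  show "vertices (closed_segment u v) \<subseteq> {u, v}"
    using extreme_points_of_convex_hull[of "{u, v}"]
    by (simp add: vertices_def segment_convex_hull)
  show "{u, v} \<subseteq> vertices (closed_segment u v)"
    using endpoint_extreme_point_of_segment[of u v] endpoint_extreme_point_of_segment[of v u]
    by (simp add: vertices_def closed_segment_commute)
qed

lemma midpoint_in_open_segment_of_neq:
  fixes a b :: "'a::real_vector"
  assumes "a \<noteq> b"
  shows "midpoint a b \<in> open_segment a b"
  using assms
  by (auto simp: in_segment midpoint_def scaleR_add_right simp del: scaleR_half_double intro!: exI[of _ "1/2"])

text \<open>
  A face through the common midpoint contains both pairs, whereas a segment has only its end points
  as vertices. This is the only obstruction to adjacency that occurs below.
\<close>
lemma not_adjacent_if_common_midpoint:
  assumes "w \<in> vertices P" "x \<in> vertices P" "w \<noteq> x" "w \<notin> {u, v}"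
    and "midpoint u v = midpoint w x"
  shows "\<not> adjacent P u v"
proof
  assume "adjacent P u v"
  then have f: "closed_segment u v face_of P"
    by (simp add: adjacent_iff)
  have "midpoint w x \<in> closed_segment u v"
    by (simp flip: assms(5))
  moreover have "w \<in> P" "x \<in> P"
    using assms(1,2) by (auto simp: vertices_def extreme_point_of_def)
  ultimately have "w \<in> closed_segment u v"
    using face_ofD[OF f midpoint_in_open_segment_of_neq[OF assms(3)]] by blast
  then have "w \<in> vertices (closed_segment u v)"
    using extreme_point_of_face[OF f] assms(1) by (auto simp: vertices_def)
  then show False
    using assms(4) by (simp add: vertices_closed_segment)
qed

lemma adjacent_commute: "adjacent P u v \<longleftrightarrow> adjacent P v u"
  by (auto simp: adjacent_iff closed_segment_commute)

text \<open>
  The definition of a combinatorial automorphism only asks that faces be mapped to faces. For edges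
  the converse follows by counting: an injection of the finite set of adjacent pairs into itself is
  onto.
\<close>
lemma comb_auts_subset_skeleton_auts:
  fixes P :: "'a::real_vector set"
  assumes fin: "finite (vertices P)" and P: "P = convex hull vertices P"
  shows "comb_auts P \<subseteq> skeleton_auts P"
proof
  fix f assume f: "f \<in> comb_auts P"
  then have Bij: "f \<in> Bij (vertices P)"
    by (simp add: comb_auts_def)
  then have inj: "inj_on f (vertices P)"
    by (simp add: Bij_def bij_betw_def)
  have fwd: "adjacent P (f u) (f v)" if uv: "adjacent P u v" for u v
  proof -
    have mem: "u \<in> vertices P" "v \<in> vertices P"
      using adjacent_vertices[OF uv] .
    have "closed_segment u v face_of P"
      using uv by (simp add: adjacent_iff)
    then obtain F where F: "F face_of P" "f ` vertices (closed_segment u v) = vertices F"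
      using f by (auto simp: comb_auts_def)
    have "F = convex hull (F \<inter> vertices P)"
      using face_of_convex_hull_eq_hull_generators[OF fin, of F] F(1) P by simp
    also have "F \<inter> vertices P = {f u, f v}"
      using F(2) extreme_point_of_face[OF F(1)]
      by (auto simp: vertices_def[of F] vertices_def[of P] vertices_closed_segment)
    finally have "F = closed_segment (f u) (f v)"
      by (simp add: segment_convex_hull)
    moreover have "f u \<noteq> f v"
      using uv inj mem by (auto simp: adjacent_iff inj_on_def)
    ultimately show ?thesis
      using F(1) by (simp add: adjacent_iff)
  qed
  define D where "D = {(u, v). adjacent P u v}"
  have D: "D \<subseteq> vertices P \<times> vertices P"
    using adjacent_vertices by (fastforce simp: D_def)
  then have "inj_on (map_prod f f) D"
    using inj by (intro inj_on_subset[OF map_prod_inj_on]) auto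
  moreover have "map_prod f f ` D \<subseteq> D"
    using fwd by (auto simp: D_def)
  moreover have "finite D"
    using D fin finite_subset by blast
  ultimately have onto: "map_prod f f ` D = D"
    by (simp add: endo_inj_surj)
  have "adjacent P u v" if "u \<in> vertices P" "v \<in> vertices P" "adjacent P (f u) (f v)" for u v
  proof -
    have "(f u, f v) \<in> map_prod f f ` D"
      using onto that(3) by (simp add: D_def)
    then obtain u' v' where D': "adjacent P u' v'" and eq: "f u' = f u" "f v' = f v"
      by (auto simp: D_def)
    have "u' = u" "v' = v"
      using eq adjacent_vertices[OF D'] that(1,2) inj by (auto dest: inj_onD)
    then show ?thesis
      using D' by simp
  qed
  then show "f \<in> skeleton_auts P"
    using Bij fwd by (auto simp: skeleton_auts_def)
qed

section \<open>Polytopes with 0/1 vertices\<close>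

lemma sum_indicator_weights:
  assumes "S \<subseteq> {..<d::nat}"
  shows "(\<Sum>i<d. a i * indicator S i) = (sum a S :: real)"
proof -
  have "(\<Sum>i<d. a i * indicator S i) = (\<Sum>i\<in>{..<d} \<inter> S. a i)"
    by (simp add: indicator_def sum.inter_restrict if_distrib cong: if_cong)
  also have "{..<d} \<inter> S = S"
    using assms by auto
  finally show ?thesis .
qed

lemma weights_linear: "linear (\<lambda>x::nat \<Rightarrow> real. \<Sum>i<d. a i * x i)"
  by (intro linearI) (simp_all add: algebra_simps sum.distrib sum_distrib_left)

lemma indicator_inject: "(indicator S :: 'a \<Rightarrow> real) = indicator T \<longleftrightarrow> S = T"
  by (metis indicator_eq_1_iff subsetI subset_antisym)

definition indicator_polytope :: "nat set set \<Rightarrow> (nat \<Rightarrow> real) set"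
  where "indicator_polytope \<F> = convex hull (indicator ` \<F>)"

text \<open>
  The vertices of a polytope with 0/1 coordinates are indicator functions, so they are handled as sets
  of coordinates.
\<close>
locale set_family =
  fixes d :: nat and \<F> :: "nat set set"
  assumes cell_subset: "S \<in> \<F> \<Longrightarrow> S \<subseteq> {..<d}"
    and nonempty: "\<F> \<noteq> {}"
begin

abbreviation P :: "(nat \<Rightarrow> real) set"
  where "P \<equiv> indicator_polytope \<F>"

lemma finite_family: "finite \<F>"
proof (rule finite_subset)
  show "\<F> \<subseteq> Pow {..<d}"
    using cell_subset by blast
qed simp

lemma face_by_weights:
  fixes a :: "nat \<Rightarrow> real"
  assumes "\<And>R. R \<in> \<F> \<Longrightarrow> sum a R \<le> c"
  shows "convex hull (indicator ` {R \<in> \<F>. sum a R = c}) face_of P"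
proof -
  let ?l = "\<lambda>x::nat \<Rightarrow> real. \<Sum>i<d. a i * x i"
  have l: "?l (indicator R) = sum a R" if "R \<in> \<F>" for R
    using sum_indicator_weights cell_subset[OF that] by blast
  have eq: "{w \<in> indicator ` \<F>. ?l w = c} = indicator ` {R \<in> \<F>. sum a R = c}"
    using l by auto
  have le: "?l w \<le> c" if "w \<in> indicator ` \<F>" for w
    using that l assms by auto
  have "convex hull {w \<in> indicator ` \<F>. ?l w = c} face_of P"
    unfolding indicator_polytope_def
    by (intro face_of_convex_hull_max weights_linear finite_imageI finite_family le)
  then show ?thesis
    by (simp only: eq)
qed

text \<open>
  No 0/1 vector is redundant: the functional with weight \<open>1\<close> on \<open>S\<close> and \<open>-1\<close> elsewhere is maximal
  over the cube at the indicator of \<open>S\<close> alone.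
\<close>
lemma vertices_eq: "vertices P = indicator ` \<F>"
proof
  show "vertices P \<subseteq> indicator ` \<F>"
    using extreme_points_of_convex_hull[of "indicator ` \<F>"]
    by (simp add: vertices_def indicator_polytope_def)
  show "indicator ` \<F> \<subseteq> vertices P"
  proof safe
    fix S assume S: "S \<in> \<F>"
    let ?a = "\<lambda>i. if i \<in> S then 1 else - 1 :: real"
    have a: "sum ?a R = real (card (R \<inter> S)) - real (card (R - S))" if "R \<in> \<F>" for R
    proof -
      have "finite R"
        using cell_subset[OF that] finite_subset by blast
      then have "sum ?a R = sum ?a (R \<inter> S) + sum ?a (R - S)"
        by (subst sum.union_disjoint[symmetric]) (auto intro: sum.cong)
      then show ?thesis
        by simp
    qed
    have fin: "finite S"
      using cell_subset[OF S] finite_subset by blast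
    have le: "sum ?a R \<le> card S" and eq: "sum ?a R = card S \<Longrightarrow> R = S" if R: "R \<in> \<F>" for R
    proof -
      have finR: "finite R"
        using cell_subset[OF R] finite_subset by blast
      have c: "card (R \<inter> S) \<le> card S"
        using fin by (auto intro: card_mono)
      then show "sum ?a R \<le> card S"
        using a[OF R] by linarith
      assume "sum ?a R = card S"
      then have "card (R \<inter> S) = card S" "card (R - S) = 0"
        using a[OF R] c by linarith+
      then have "R \<inter> S = S" "R - S = {}"
        using card_subset_eq[OF fin, of "R \<inter> S"] finR by simp_all
      then show "R = S"
        by auto
    qed
    have "{R \<in> \<F>. sum ?a R = card S} = {S}"
      using S eq by auto
    then have "{indicator S} face_of P"
      using face_by_weights[of ?a "card S"] le by simp
    then show "indicator S \<in> vertices P"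
      by (simp add: vertices_def face_of_singleton)
  qed
qed

lemma P_eq_hull_vertices: "P = convex hull vertices P"
  unfolding vertices_eq by (simp add: indicator_polytope_def)

lemma finite_vertices: "finite (vertices P)"
  by (simp add: vertices_eq finite_family)

lemma convex_polytope: "convex_polytope_in d P"
proof -
  have "indicator ` \<F> \<subseteq> euclid d"
    using cell_subset by (fastforce simp: euclid_def indicator_def)
  then show ?thesis
    unfolding convex_polytope_in_def indicator_polytope_def
    using finite_family nonempty by (intro exI[of _ "indicator ` \<F>"]) simp
qed

lemma binary: "binary_polytope d P"
  by (auto simp: binary_polytope_def vertices_eq indicator_def)

definition adj :: "nat set \<Rightarrow> nat set \<Rightarrow> bool"
  where "adj S T \<longleftrightarrow> adjacent P (indicator S) (indicator T)"

lemma adj_commute: "adj S T \<longleftrightarrow> adj T S"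
  by (simp add: adj_def adjacent_commute)

lemma adj_cells: "adj S T \<Longrightarrow> S \<in> \<F> \<and> T \<in> \<F> \<and> S \<noteq> T"
  using adjacent_vertices[of P "indicator S" "indicator T"]
  by (auto simp: adj_def vertices_eq indicator_inject adjacent_iff)

lemma adj_by_weights:
  fixes a :: "nat \<Rightarrow> real"
  assumes "S \<in> \<F>" "T \<in> \<F>" "S \<noteq> T" and "sum a S = c" "sum a T = c"
    and "\<And>R. R \<in> \<F> \<Longrightarrow> R \<noteq> S \<Longrightarrow> R \<noteq> T \<Longrightarrow> sum a R < c"
  shows "adj S T"
proof -
  have "sum a R \<le> c" if "R \<in> \<F>" for R
    using assms(4-) that by (cases "R = S \<or> R = T") (auto intro: less_imp_le)
  moreover have "{R \<in> \<F>. sum a R = c} = {S, T}"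
    using assms by fastforce
  ultimately have "closed_segment (indicator S) (indicator T) face_of P"
    using face_by_weights[of a c] by (simp add: segment_convex_hull)
  then show ?thesis
    using assms(3) by (simp add: adj_def adjacent_iff indicator_inject)
qed

lemma midpoint_indicator_eq:
  assumes "\<And>i. (of_bool (i \<in> S) + of_bool (i \<in> T) :: nat) = of_bool (i \<in> S') + of_bool (i \<in> T')"
  shows "midpoint (indicator S) (indicator T) = (midpoint (indicator S') (indicator T') :: nat \<Rightarrow> real)"
proof -
  have "(indicator S + indicator T :: nat \<Rightarrow> real) = indicator S' + indicator T'"
  proof
    fix i
    show "(indicator S + indicator T) i = (indicator S' + indicator T' :: nat \<Rightarrow> real) i"
      using assms[of i]
      by (cases "i \<in> S"; cases "i \<in> T"; cases "i \<in> S'"; cases "i \<in> T'") simp_all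
  qed
  then show ?thesis
    by (simp add: midpoint_def)
qed

end

definition permute_coords :: "('i \<Rightarrow> 'i) \<Rightarrow> ('i \<Rightarrow> real) \<Rightarrow> ('i \<Rightarrow> real)"
  where "permute_coords \<tau> x = x \<circ> inv_into UNIV \<tau>"

lemma linear_permute_coords: "linear (permute_coords \<tau>)"
  by (intro linearI) (auto simp: permute_coords_def fun_eq_iff)

lemma inj_permute_coords: "bij \<tau> \<Longrightarrow> inj (permute_coords \<tau>)"
proof (rule injI)
  fix x y :: "'a \<Rightarrow> real"
  assume "bij \<tau>" and eq: "permute_coords \<tau> x = permute_coords \<tau> y"
  then have inv: "inv_into UNIV \<tau> (\<tau> i) = i" for i
    by (simp add: bij_is_inj)
  show "x = y"
  proof
    fix i
    show "x i = y i"
      using fun_cong[OF eq, of "\<tau> i"] by (simp add: permute_coords_def inv)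
  qed
qed

lemma permute_coords_indicator:
  assumes "bij \<tau>"
  shows "permute_coords \<tau> (indicator S) = indicator (\<tau> ` S)"
proof
  fix i
  have "inv_into UNIV \<tau> i \<in> S \<longleftrightarrow> i \<in> \<tau> ` S"
    using assms by (metis bij_inv_eq_iff image_iff)
  then show "permute_coords \<tau> (indicator S) i = indicator (\<tau> ` S) i"
    by (simp add: permute_coords_def indicator_def)
qed

lemma permute_coords_comp:
  "bij \<tau> \<Longrightarrow> bij \<rho> \<Longrightarrow> permute_coords (\<tau> \<circ> \<rho>) x = permute_coords \<tau> (permute_coords \<rho> x)"
  by (simp add: permute_coords_def o_inv_distrib comp_assoc)

lemma (in set_family) permute_coords_image:
  assumes \<tau>: "bij \<tau>" and \<F>: "(`) \<tau> ` \<F> = \<F>"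
  shows "permute_coords \<tau> ` P = P"
proof -
  have "permute_coords \<tau> ` indicator ` \<F> = indicator ` (`) \<tau> ` \<F>"
    by (simp add: image_image permute_coords_indicator[OF \<tau>])
  then show ?thesis
    by (simp add: indicator_polytope_def convex_hull_linear_image[OF linear_permute_coords] \<F>)
qed

lemma (in set_family) permute_coords_isometry:
  assumes \<tau>: "\<tau> permutes {..<d}" and \<F>: "(`) \<tau> ` \<F> = \<F>"
  shows "restrict (permute_coords \<tau>) (euclid d) \<in> isometries_of d P"
proof -
  have bij: "bij \<tau>"
    using \<tau> by (rule permutes_bij)
  have inv: "inv_into UNIV \<tau> permutes {..<d}"
    using \<tau> by (rule permutes_inv)
  have "inv_into UNIV \<tau> i = i" if "d \<le> i" for i
    using inv that by (auto simp: permutes_def)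
  then have sub: "permute_coords \<tau> x \<in> euclid d" if "x \<in> euclid d" for x
    using that by (auto simp: euclid_def permute_coords_def)
  have "x \<in> permute_coords \<tau> ` euclid d" if "x \<in> euclid d" for x
  proof (rule image_eqI)
    show "x = permute_coords \<tau> (x \<circ> \<tau>)"
      using bij by (auto simp: permute_coords_def fun_eq_iff bij_is_surj surj_f_inv_f)
    show "x \<circ> \<tau> \<in> euclid d"
      using that \<tau> by (auto simp: euclid_def permutes_def)
  qed
  then have onto: "permute_coords \<tau> ` euclid d = euclid d"
    using sub by auto
  have "bij_betw (permute_coords \<tau>) (euclid d) (euclid d)"
    using onto inj_on_subset[OF inj_permute_coords[OF bij]] by (auto simp: bij_betw_def)
  then have "restrict (permute_coords \<tau>) (euclid d) \<in> Bij (euclid d)"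
    by (simp add: Bij_def)
  moreover have "euclid_dist d (permute_coords \<tau> x) (permute_coords \<tau> y) = euclid_dist d x y" for x y
    using sum.permute[OF inv, of "\<lambda>i. (x i - y i)\<^sup>2"]
    by (simp add: euclid_dist_def L2_set_def permute_coords_def comp_def)
  moreover have "P \<subseteq> euclid d"
  proof -
    have "convex (euclid d)"
      by (auto simp: convex_def euclid_def)
    then show ?thesis
      using cell_subset unfolding indicator_polytope_def
      by (intro hull_minimal) (fastforce simp: euclid_def indicator_def)+
  qed
  moreover have "permute_coords \<tau> ` P = P"
    using permute_coords_image[OF bij \<F>] .
  ultimately show ?thesis
    by (auto simp: isometries_of_def isometries_def subset_iff cong: image_cong)
qed

lemma (in set_family) permute_coords_comb_aut:
  assumes \<tau>: "bij \<tau>" and \<F>: "(`) \<tau> ` \<F> = \<F>"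
  shows "restrict (permute_coords \<tau>) (vertices P) \<in> comb_auts P"
proof -
  let ?T = "permute_coords \<tau>"
  note lin = linear_permute_coords[of \<tau>] inj_permute_coords[OF \<tau>]
  have TP: "?T ` P = P"
    using permute_coords_image[OF assms] .
  have TV: "?T ` vertices F = vertices (?T ` F)" for F
  proof
    have *: "v extreme_point_of F \<longleftrightarrow> ?T v extreme_point_of ?T ` F" for v
      using face_of_linear_image[OF lin, of "{v}" F] by (simp add: face_of_singleton)
    show "?T ` vertices F \<subseteq> vertices (?T ` F)"
      using * by (auto simp: vertices_def)
    show "vertices (?T ` F) \<subseteq> ?T ` vertices F"
      using * by (auto simp: vertices_def extreme_point_of_def)
  qed
  have "bij_betw ?T (vertices P) (vertices P)"
    using TV[of P] TP inj_on_subset[OF lin(2)] by (auto simp: bij_betw_def)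
  moreover have "restrict ?T (vertices P) ` vertices F = vertices (?T ` F)" "?T ` F face_of P"
    if "F face_of P" for F
  proof -
    have "vertices F \<subseteq> vertices P"
      using extreme_point_of_face[OF that] by (auto simp: vertices_def)
    then have "restrict ?T (vertices P) ` vertices F = ?T ` vertices F"
      by (intro image_cong) auto
    then show "restrict ?T (vertices P) ` vertices F = vertices (?T ` F)"
      using TV[of F] by simp
    show "?T ` F face_of P"
      using face_of_linear_image[OF lin, of F P] that unfolding TP by blast
  qed
  ultimately show ?thesis
    unfolding comb_auts_def Bij_def
    by (intro CollectI conjI IntI restrict_extensional allI impI exI[of _ "?T ` _"])
       (simp_all add: bij_betw_restrict_eq)
qed

section \<open>The polytope of a graph\<close>

locale nat_graph =
  fixes d :: nat and E :: "nat \<Rightarrow> nat \<Rightarrow> bool"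
  assumes edge_less: "E u v \<Longrightarrow> u < d"
    and edge_sym: "E u v \<Longrightarrow> E v u"
    and edge_irrefl: "\<not> E u u"
begin

definition cells :: "nat set set"
  where "cells = insert {} ((\<lambda>u. {u}) ` {..<d} \<union> {{u, v} |u v. E u v})"

lemma edge_less2: "E u v \<Longrightarrow> v < d"
  using edge_less edge_sym by blast

lemma edge_commute: "E u v \<longleftrightarrow> E v u"
  using edge_sym by blast

lemma empty_cell: "{} \<in> cells"
  by (simp add: cells_def)

lemma single_cell: "u < d \<Longrightarrow> {u} \<in> cells"
  by (simp add: cells_def)

lemma edge_cell: "E u v \<Longrightarrow> {u, v} \<in> cells"
  by (auto simp: cells_def)

lemma cells_cases:
  assumes "S \<in> cells"
  obtains "S = {}" | u where "u < d" "S = {u}" | u v where "E u v" "u \<noteq> v" "S = {u, v}"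
proof -
  consider "S = {}" | u where "u < d" "S = {u}" | u v where "E u v" "S = {u, v}"
    using assms by (auto simp: cells_def)
  then show ?thesis
    using that edge_irrefl by cases blast+
qed

sublocale set_family d cells
proof
  show "S \<subseteq> {..<d}" if "S \<in> cells" for S
    using that edge_less edge_less2 by (auto elim!: cells_cases)
  show "cells \<noteq> {}"
    using empty_cell by blast
qed

lemma adj_by_graph_weights:
  fixes a :: "nat \<Rightarrow> real"
  assumes "S \<in> cells" "T \<in> cells" "S \<noteq> T" "sum a S = c" "sum a T = c"
    and "S \<noteq> {} \<Longrightarrow> T \<noteq> {} \<Longrightarrow> 0 < c"
    and "\<And>y. y < d \<Longrightarrow> {y} \<noteq> S \<Longrightarrow> {y} \<noteq> T \<Longrightarrow> a y < c"
    and "\<And>y z. E y z \<Longrightarrow> y \<noteq> z \<Longrightarrow> {y, z} \<noteq> S \<Longrightarrow> {y, z} \<noteq> T \<Longrightarrow> a y + a z < c"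
  shows "adj S T"
proof (rule adj_by_weights[of S T a c])
  fix R assume R: "R \<in> cells" "R \<noteq> S" "R \<noteq> T"
  from R(1) show "sum a R < c"
    by (cases rule: cells_cases) (use R assms in auto)
qed (use assms in auto)

text \<open>
  For each of the adjacent pairs below the weights favour the nodes of the pair and are negative on all
  others; the assumed nonedges are those that would be too heavy.
\<close>
lemma adj_empty_single:
  assumes "u < d"
  shows "adj {} {u}"
  by (rule adj_by_graph_weights[where a = "\<lambda>i. if i = u then 0 else - 1" and c = 0])
     (use assms in \<open>auto simp: empty_cell single_cell\<close>)

lemma adj_single_single:
  assumes "u < d" "v < d" "u \<noteq> v" "\<not> E u v"
  shows "adj {u} {v}"
  by (rule adj_by_graph_weights[where a = "\<lambda>i. if i = u \<or> i = v then 1 else - 1" and c = 1])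
     (use assms edge_commute[of u v] in \<open>auto simp: single_cell\<close>)

lemma adj_single_edge_incident:
  assumes "E u v"
  shows "adj {u} {u, v}"
proof -
  have "u \<noteq> v"
    using assms edge_irrefl by blast
  then show ?thesis
    by (intro adj_by_graph_weights[where a = "\<lambda>i. if i = u then 1 else if i = v then 0 else - 1" and c = 1])
       (use assms edge_less[OF assms] in \<open>auto simp: single_cell edge_cell doubleton_eq_iff\<close>)
qed

lemma adj_single_edge:
  assumes "w < d" "E u v" "w \<noteq> u" "w \<noteq> v" "\<not> E w u" "\<not> E w v"
  shows "adj {w} {u, v}"
proof -
  have "u \<noteq> v"
    using assms edge_irrefl by blast
  then show ?thesis
    by (intro adj_by_graph_weights[where c = 2 and
          a = "\<lambda>i. if i = w then 2 else if i = u \<or> i = v then 1 else - 3"])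
       (use assms edge_commute in \<open>auto simp: single_cell edge_cell doubleton_eq_iff\<close>)
qed

lemma adj_edge_edge_incident:
  assumes "E u v" "E u w" "v \<noteq> w"
  shows "adj {u, v} {u, w}"
proof -
  have "u \<noteq> v" "u \<noteq> w"
    using assms edge_irrefl by blast+
  then show ?thesis
    by (intro adj_by_graph_weights[where c = 3 and
          a = "\<lambda>i. if i = u then 2 else if i = v \<or> i = w then 1 else - 3"])
       (use assms in \<open>auto simp: edge_cell doubleton_eq_iff\<close>)
qed

lemma adj_edge_edge:
  assumes "E u v" "E w x" "{w, x} \<inter> {u, v} = {}" "\<not> E w u" "\<not> E w v"
  shows "adj {u, v} {w, x}"
proof -
  (* Since w has no neighbour in {u, v} it may be heavy: both edges weigh 10, while an edge from x
     to u or v weighs only 7. *)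
  define a :: "nat \<Rightarrow> real"
    where "a i = (if i = w then 8 else if i = x then 2 else if i = u \<or> i = v then 5 else - 20)" for i
  have ne: "u \<noteq> v" "w \<noteq> x" "w \<noteq> u" "w \<noteq> v" "x \<noteq> u" "x \<noteq> v"
    using assms edge_irrefl by blast+
  then have a: "a w = 8" "a x = 2" "a u = 5" "a v = 5"
    by (auto simp: a_def)
  have a_le: "a i \<le> 8" and a_out: "i \<notin> {u, v, w, x} \<Longrightarrow> a i = - 20" for i
    by (auto simp: a_def)
  have nE: "\<not> E u w" "\<not> E v w"
    using assms edge_sym by blast+
  show ?thesis
  proof (rule adj_by_graph_weights[of _ _ a 10])
    show "{u, v} \<in> cells" "{w, x} \<in> cells" "{u, v} \<noteq> {w, x}"
      using assms edge_cell by auto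
    show "sum a {u, v} = 10" "sum a {w, x} = 10"
      using ne a by auto
    show "a y < 10" for y
      using a_le[of y] by simp
    show "a y + a z < 10" if yz: "E y z" "y \<noteq> z" "{y, z} \<noteq> {u, v}" "{y, z} \<noteq> {w, x}" for y z
    proof (cases "y \<in> {u, v, w, x} \<and> z \<in> {u, v, w, x}")
      case True
      then have "y = u \<or> y = v \<or> y = w \<or> y = x" "z = u \<or> z = v \<or> z = w \<or> z = x"
        by auto
      then show ?thesis
        using yz nE assms(4,5) by (elim disjE) (simp_all add: a insert_commute)
    next
      case False
      then show ?thesis
        using a_le[of y] a_le[of z] a_out[of y] a_out[of z] by auto
    qed
  qed simp
qed

text \<open>
  The sets \<open>S\<close> and \<open>T\<close> are a diagonal of a parallelogram of vertices. The adjacency of the corner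
  \<open>S'\<close> to both ends of the diagonal is recorded as well, since it bounds the diameter.
\<close>
definition opposite :: "nat set \<Rightarrow> nat set \<Rightarrow> bool"
  where "opposite S T \<longleftrightarrow> (\<exists>S'\<in>cells - {S, T}. \<exists>T'\<in>cells - {S, T}. S' \<noteq> T' \<and>
    (\<forall>i. (of_bool (i \<in> S) + of_bool (i \<in> T) :: nat) = of_bool (i \<in> S') + of_bool (i \<in> T')) \<and>
    adj S S' \<and> adj S' T)"

lemma oppositeI:
  assumes "S' \<in> cells" "T' \<in> cells" "S' \<noteq> S" "S' \<noteq> T" "T' \<noteq> S" "T' \<noteq> T" "S' \<noteq> T'"
    and "\<And>i. (of_bool (i \<in> S) + of_bool (i \<in> T) :: nat) = of_bool (i \<in> S') + of_bool (i \<in> T')"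
    and "adj S S'" "adj S' T"
  shows "opposite S T"
  using assms unfolding opposite_def by blast

lemma opposite_commute:
  assumes "opposite S T"
  shows "opposite T S"
proof -
  obtain S' T' where *: "S' \<in> cells - {S, T}" "T' \<in> cells - {S, T}" "S' \<noteq> T'"
    "\<And>i. (of_bool (i \<in> S) + of_bool (i \<in> T) :: nat) = of_bool (i \<in> S') + of_bool (i \<in> T')"
    "adj S S'" "adj S' T"
    using assms unfolding opposite_def by blast
  show ?thesis
    by (rule oppositeI[of S' T']) (use * adj_commute in \<open>auto simp: add.commute\<close>)
qed

lemma opposite_midpoint:
  assumes "opposite S T"
  obtains S' T' where "S' \<in> cells - {S, T}" "T' \<in> cells - {S, T}" "S' \<noteq> T'"
    and "midpoint (indicator S) (indicator T) = (midpoint (indicator S') (indicator T') :: nat \<Rightarrow> real)"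
  using assms midpoint_indicator_eq unfolding opposite_def by meson

lemma opposite_not_adj:
  assumes "opposite S T"
  shows "\<not> adj S T"
proof -
  obtain S' T' where S'T': "S' \<in> cells - {S, T}" "T' \<in> cells - {S, T}" "S' \<noteq> T'"
    and eq: "midpoint (indicator S) (indicator T) = (midpoint (indicator S') (indicator T') :: nat \<Rightarrow> real)"
    using assms by (rule opposite_midpoint)
  show ?thesis
    unfolding adj_def
    by (rule not_adjacent_if_common_midpoint[OF _ _ _ _ eq])
       (use S'T' in \<open>auto simp: vertices_eq indicator_inject\<close>)
qed

lemma opposite_empty_edge:
  assumes "E u v"
  shows "opposite {} {u, v}"
proof (rule oppositeI[of "{u}" "{v}"])
  have "u \<noteq> v"
    using assms edge_irrefl by blast
  then show "{u} \<noteq> {v}" "{u} \<noteq> {u, v}" "{v} \<noteq> {u, v}"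
    "\<And>i. (of_bool (i \<in> {}) + of_bool (i \<in> {u, v}) :: nat) = of_bool (i \<in> {u}) + of_bool (i \<in> {v})"
    by auto
qed (use assms edge_less edge_less2 single_cell adj_empty_single adj_single_edge_incident in auto)

lemma opposite_single_single:
  assumes "E u v"
  shows "opposite {u} {v}"
proof (rule oppositeI[of "{}" "{u, v}"])
  have "u \<noteq> v"
    using assms edge_irrefl by blast
  then show "{u, v} \<noteq> {u}" "{u, v} \<noteq> {v}"
    "\<And>i. (of_bool (i \<in> {u}) + of_bool (i \<in> {v}) :: nat) = of_bool (i \<in> {}) + of_bool (i \<in> {u, v})"
    by auto
  show "adj {u} {}" "adj {} {v}"
    using assms edge_less edge_less2 adj_empty_single adj_commute by blast+
qed (use assms empty_cell edge_cell in auto)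

lemma opposite_single_edge:
  assumes "E u v" "w \<noteq> v" "E w u"
  shows "opposite {w} {u, v}"
proof (rule oppositeI[of "{w, u}" "{v}"])
  have "u \<noteq> v" "w \<noteq> u"
    using assms edge_irrefl by blast+
  then show "{w, u} \<noteq> {v}" "{w, u} \<noteq> {w}" "{w, u} \<noteq> {u, v}" "{v} \<noteq> {w}" "{v} \<noteq> {u, v}"
    "\<And>i. (of_bool (i \<in> {w}) + of_bool (i \<in> {u, v}) :: nat) = of_bool (i \<in> {w, u}) + of_bool (i \<in> {v})"
    using assms(2) by (auto simp: doubleton_eq_iff)
  show "adj {w} {w, u}"
    using assms(3) by (rule adj_single_edge_incident)
  show "adj {w, u} {u, v}"
    using adj_edge_edge_incident[of u w v] assms edge_sym by (simp add: insert_commute)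
qed (use assms edge_cell single_cell edge_less2 in auto)

lemma opposite_edge_edge:
  assumes "E u v" "E w x" "{w, x} \<inter> {u, v} = {}" "E u w" "E v x"
  shows "opposite {u, v} {w, x}"
proof (rule oppositeI[of "{u, w}" "{v, x}"])
  have "u \<noteq> v" "w \<noteq> x"
    using assms edge_irrefl by blast+
  then show "{u, w} \<noteq> {v, x}" "{u, w} \<noteq> {u, v}" "{u, w} \<noteq> {w, x}" "{v, x} \<noteq> {u, v}" "{v, x} \<noteq> {w, x}"
    "\<And>i. (of_bool (i \<in> {u, v}) + of_bool (i \<in> {w, x}) :: nat) = of_bool (i \<in> {u, w}) + of_bool (i \<in> {v, x})"
    using assms(3) by (auto simp: doubleton_eq_iff)
  show "adj {u, v} {u, w}"
    using adj_edge_edge_incident assms by auto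
  show "adj {u, w} {w, x}"
    using adj_edge_edge_incident[of w u x] assms edge_sym by (auto simp: insert_commute)
qed (use assms edge_cell in auto)

text \<open>
  The dichotomy behind both combinatoriality and the diameter bound. For two disjoint edges without a
  second perfect matching on their four nodes, some node has no neighbour in the other edge, and
  \<open>adj_edge_edge\<close> applies with that node as \<open>w\<close>.
\<close>
lemma adj_or_opposite:
  assumes S: "S \<in> cells" and T: "T \<in> cells" and "S \<noteq> T"
  shows "adj S T \<or> opposite S T"
proof -
  define good where "good S T \<longleftrightarrow> adj S T \<or> opposite S T" for S T
  have sym: "good T S" if "good S T" for S T
    using that adj_commute opposite_commute by (auto simp: good_def)
  have empty: "good {} R" if R: "R \<in> cells" "R \<noteq> {}" for R
    using R(1) by (cases rule: cells_cases)
      (use R(2) adj_empty_single opposite_empty_edge in \<open>auto simp: good_def\<close>)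
  have single_single: "good {u} {v}" if "u < d" "v < d" "u \<noteq> v" for u v
    using that adj_single_single opposite_single_single by (auto simp: good_def)
  have single_edge: "good {w} {u, v}" if w: "w < d" and uv: "E u v" for w u v
  proof -
    consider "w = u" | "w = v" | "w \<noteq> u" "w \<noteq> v" "E w u" | "w \<noteq> u" "w \<noteq> v" "E w v"
      | "w \<noteq> u" "w \<noteq> v" "\<not> E w u" "\<not> E w v"
      by blast
    then show ?thesis
    proof cases
      case 1
      then show ?thesis using adj_single_edge_incident[OF uv] by (simp add: good_def)
    next
      case 2
      then show ?thesis
        using adj_single_edge_incident[OF edge_sym[OF uv]] by (simp add: good_def insert_commute)
    next
      case 3
      then show ?thesis using opposite_single_edge[OF uv] by (simp add: good_def)
    next
      case 4
      then show ?thesis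
        using opposite_single_edge[OF edge_sym[OF uv]] by (simp add: good_def insert_commute)
    next
      case 5
      then show ?thesis using adj_single_edge w uv by (simp add: good_def)
    qed
  qed
  have edge_edge: "good {u, v} {w, x}" if uv: "E u v" and wx: "E w x" and ne: "{u, v} \<noteq> {w, x}" for u v w x
  proof (cases "{w, x} \<inter> {u, v} = {}")
    case True
    then have True': "{u, v} \<inter> {w, x} = {}"
      by blast
    consider "E u w" "E v x" | "E u x" "E v w"
      | "\<not> E w u" "\<not> E w v" | "\<not> E x u" "\<not> E x v" | "\<not> E u w" "\<not> E u x" | "\<not> E v w" "\<not> E v x"
      using edge_commute by blast
    then show ?thesis
    proof cases
      case 1
      then show ?thesis using opposite_edge_edge[OF uv wx True] by (simp add: good_def)
    next
      case 2
      then show ?thesis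
        using opposite_edge_edge[OF uv edge_sym[OF wx]] True by (simp add: good_def insert_commute)
    next
      case 3
      then show ?thesis using adj_edge_edge[OF uv wx True] by (simp add: good_def)
    next
      case 4
      then show ?thesis
        using adj_edge_edge[OF uv edge_sym[OF wx]] True by (simp add: good_def insert_commute)
    next
      case 5
      then show ?thesis
        using adj_edge_edge[OF wx uv True'] adj_commute by (simp add: good_def)
    next
      case 6
      then show ?thesis
        using adj_edge_edge[OF wx edge_sym[OF uv]] True' adj_commute
        by (simp add: good_def insert_commute)
    qed
  next
    case False
    have share: "good {u, v} {u, w}" if "E u v" "E u w" "v \<noteq> w" for u v w
      using that adj_edge_edge_incident by (simp add: good_def)
    consider "w = u" | "w = v" | "x = u" | "x = v"
      using False by blast
    then show ?thesis
      using share[of u v x] share[of v u x] share[of u v w] share[of v u w] uv wx ne edge_sym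
      by cases (auto simp: insert_commute)
  qed
  from S have "good S T"
  proof (cases rule: cells_cases)
    case 1
    then show ?thesis using empty T assms(3) by blast
  next
    case u: (2 u)
    from T show ?thesis
      by (cases rule: cells_cases)
         (use u sym empty single_single single_edge S assms(3) in auto)
  next
    case uv: (3 u v)
    from T show ?thesis
      by (cases rule: cells_cases)
         (use uv sym empty single_edge edge_edge S assms(3) in auto)
  qed
  then show ?thesis
    by (simp add: good_def)
qed

lemma combinatorial: "combinatorial_polytope d P"
proof -
  have "\<exists>w\<in>vertices P - {u, v}. \<exists>x\<in>vertices P - {u, v}. w \<noteq> x \<and> midpoint u v = midpoint w x"
    if uv: "u \<in> vertices P" "v \<in> vertices P" "u \<noteq> v" "\<not> adjacent P u v" for u v
  proof -
    obtain S T where ST: "S \<in> cells" "T \<in> cells" "u = indicator S" "v = indicator T"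
      using uv by (auto simp: vertices_eq)
    then have "opposite S T"
      using adj_or_opposite[of S T] uv by (auto simp: adj_def)
    then obtain S' T' where "S' \<in> cells - {S, T}" "T' \<in> cells - {S, T}" "S' \<noteq> T'"
      and "midpoint (indicator S) (indicator T) = (midpoint (indicator S') (indicator T') :: nat \<Rightarrow> real)"
      by (rule opposite_midpoint)
    then show ?thesis
      unfolding ST(3,4) vertices_eq
      by (intro bexI[of _ "indicator S'"] bexI[of _ "indicator T'"]) (auto simp: indicator_inject)
  qed
  then show ?thesis
    using binary by (auto simp: combinatorial_polytope_def)
qed

lemma diameter: "skeleton_diameter P \<le> 2"
proof -
  have "skeleton_dist P u v \<le> 2" if uv: "u \<in> vertices P" "v \<in> vertices P" for u v
  proof -
    obtain S T where ST: "S \<in> cells" "T \<in> cells" "u = indicator S" "v = indicator T"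
      using uv by (auto simp: vertices_eq)
    consider "u = v" | "adjacent P u v" | "opposite S T"
      using adj_or_opposite[of S T] ST by (auto simp: adj_def)
    then have "\<exists>k\<le>2. (adjacent P ^^ k) u v"
    proof cases
      case 1
      then show ?thesis by (intro exI[of _ 0]) simp
    next
      case 2
      then show ?thesis by (intro exI[of _ "Suc 0"]) auto
    next
      case 3
      then obtain R where "adjacent P u (indicator R)" "adjacent P (indicator R) v"
        unfolding opposite_def adj_def ST(3,4) by blast
      then have "(adjacent P ^^ Suc (Suc 0)) u v"
        by auto
      then show ?thesis
        by (intro exI[of _ "Suc (Suc 0)"]) simp
    qed
    then obtain k where "k \<le> 2" "(adjacent P ^^ k) u v"
      by blast
    then have "skeleton_dist P u v \<le> enat k" "enat k \<le> 2"
      by (auto simp: skeleton_dist_def numeral_eq_enat intro: INF_lower)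
    then show ?thesis
      by (rule order_trans)
  qed
  then show ?thesis
    by (auto simp: skeleton_diameter_def intro!: SUP_least)
qed

end

section \<open>Graphs recovered from the skeleton of their polytope\<close>

definition graph_auts :: "nat \<Rightarrow> (nat \<Rightarrow> nat \<Rightarrow> bool) \<Rightarrow> (nat \<Rightarrow> nat) set"
  where "graph_auts d E = {\<tau>. \<tau> permutes {..<d} \<and> (\<forall>u<d. \<forall>v<d. E (\<tau> u) (\<tau> v) \<longleftrightarrow> E u v)}"

text \<open>
  The nodes \<open>y\<close> for which the unit vector of \<open>y\<close> is not adjacent to the vertex of the edge \<open>uv\<close>; see
  \<open>adj_single_edge_iff\<close>.
\<close>
definition edge_nbrs :: "('v \<Rightarrow> 'v \<Rightarrow> bool) \<Rightarrow> 'v \<Rightarrow> 'v \<Rightarrow> 'v set"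
  where "edge_nbrs E u v = {y. (E u y \<or> E v y) \<and> y \<noteq> u \<and> y \<noteq> v}"

context nat_graph
begin

lemma graph_aut_image_cells:
  assumes "\<tau> \<in> graph_auts d E"
  shows "(`) \<tau> ` cells = cells"
proof -
  have \<tau>: "\<tau> permutes {..<d}" and E: "u < d \<Longrightarrow> v < d \<Longrightarrow> E (\<tau> u) (\<tau> v) \<longleftrightarrow> E u v" for u v
    using assms by (auto simp: graph_auts_def)
  have lt: "\<tau> u < d" if "u < d" for u
    using permutes_in_image[OF \<tau>, of u] that by simp
  have "(`) \<tau> ` cells \<subseteq> cells"
  proof safe
    fix S assume "S \<in> cells"
    then show "\<tau> ` S \<in> cells"
      by (cases rule: cells_cases)
         (use lt E edge_less edge_less2 empty_cell single_cell edge_cell in auto)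
  qed
  moreover have "inj_on ((`) \<tau>) cells"
    using permutes_inj[OF \<tau>] by (meson inj_image_eq_iff inj_onI)
  ultimately show ?thesis
    using finite_family by (simp add: endo_inj_surj)
qed

lemma graph_aut_comb_aut:
  assumes "\<tau> \<in> graph_auts d E"
  shows "restrict (permute_coords \<tau>) (vertices P) \<in> comb_auts P"
  using assms permute_coords_comb_aut[OF _ graph_aut_image_cells[OF assms]]
  by (auto simp: graph_auts_def dest: permutes_bij)

lemma graph_aut_isometry:
  assumes "\<tau> \<in> graph_auts d E"
  shows "\<exists>g\<in>isometries_of d P. \<forall>v\<in>vertices P. restrict (permute_coords \<tau>) (vertices P) v = g v"
proof (intro bexI ballI)
  show "restrict (permute_coords \<tau>) (euclid d) \<in> isometries_of d P"
    using assms permute_coords_isometry graph_aut_image_cells by (auto simp: graph_auts_def)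
  fix v assume v: "v \<in> vertices P"
  then have "v \<in> euclid d"
    using cell_subset by (fastforce simp: vertices_eq euclid_def indicator_def)
  then show "restrict (permute_coords \<tau>) (vertices P) v = restrict (permute_coords \<tau>) (euclid d) v"
    using v by simp
qed

lemma permute_coords_vertices_inject:
  assumes "\<tau> \<in> graph_auts d E" "\<rho> \<in> graph_auts d E"
    and eq: "restrict (permute_coords \<tau>) (vertices P) = restrict (permute_coords \<rho>) (vertices P)"
  shows "\<tau> = \<rho>"
proof
  fix i
  have \<tau>: "\<tau> permutes {..<d}" and \<rho>: "\<rho> permutes {..<d}"
    using assms by (auto simp: graph_auts_def)
  show "\<tau> i = \<rho> i"
  proof (cases "i < d")
    case True
    then have "indicator {i} \<in> vertices P"
      by (simp add: vertices_eq single_cell)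
    then have "(indicator {\<tau> i} :: nat \<Rightarrow> real) = indicator {\<rho> i}"
      using fun_cong[OF eq, of "indicator {i}"]
        permute_coords_indicator[OF permutes_bij[OF \<tau>], of "{i}"]
        permute_coords_indicator[OF permutes_bij[OF \<rho>], of "{i}"] by simp
    then show ?thesis
      by (simp add: indicator_inject)
  next
    case False
    then show ?thesis
      using permutes_not_in[OF \<tau>, of i] permutes_not_in[OF \<rho>, of i] by simp
  qed
qed

definition nbrs :: "nat set \<Rightarrow> nat set set"
  where "nbrs S = {T. adj S T}"

lemma finite_nbrs: "finite (nbrs S)"
  using finite_subset[OF _ finite_family, of "nbrs S"] adj_cells by (auto simp: nbrs_def)

lemma nbrs_empty: "nbrs {} = (\<lambda>u. {u}) ` {..<d}"
proof
  show "(\<lambda>u. {u}) ` {..<d} \<subseteq> nbrs {}"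
    using adj_empty_single by (auto simp: nbrs_def)
  show "nbrs {} \<subseteq> (\<lambda>u. {u}) ` {..<d}"
  proof
    fix T assume "T \<in> nbrs {}"
    then have T: "adj {} T" "T \<in> cells" "T \<noteq> {}"
      using adj_cells[of "{}" T] by (auto simp: nbrs_def)
    from T(2) show "T \<in> (\<lambda>u. {u}) ` {..<d}"
      by (cases rule: cells_cases) (use T opposite_empty_edge opposite_not_adj in auto)
  qed
qed

lemma card_nbrs_empty: "card (nbrs {}) = d"
  by (simp add: nbrs_empty card_image)

lemma card_nbrs_gt:
  assumes "inj_on f {..<d}" "\<And>w. w < d \<Longrightarrow> adj S (f w)" "adj S X" "X \<notin> f ` {..<d}"
  shows "d < card (nbrs S)"
proof -
  have "card (insert X (f ` {..<d})) = Suc d"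
    using assms by (simp add: card_image)
  moreover have "card (insert X (f ` {..<d})) \<le> card (nbrs S)"
    using assms by (intro card_mono finite_nbrs) (auto simp: nbrs_def)
  ultimately show ?thesis
    by simp
qed

lemma adj_single_edge_iff:
  assumes "y < d" "E u v"
  shows "adj {y} {u, v} \<longleftrightarrow> y \<notin> edge_nbrs E u v"
proof -
  consider "y = u" | "y = v" | "y \<noteq> u" "y \<noteq> v" "E y u" | "y \<noteq> u" "y \<noteq> v" "E y v"
    | "y \<noteq> u" "y \<noteq> v" "\<not> E y u" "\<not> E y v"
    by blast
  then show ?thesis
  proof cases
    case 1
    then show ?thesis
      using adj_single_edge_incident assms by (simp add: edge_nbrs_def)
  next
    case 2
    then show ?thesis
      using adj_single_edge_incident[OF edge_sym[OF assms(2)]] by (simp add: edge_nbrs_def insert_commute)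
  next
    case 3
    then show ?thesis
      using opposite_single_edge[OF assms(2), of y] opposite_not_adj edge_sym by (auto simp: edge_nbrs_def)
  next
    case 4
    then have "opposite {y} {v, u}"
      using opposite_single_edge[OF edge_sym[OF assms(2)], of y] by simp
    then show ?thesis
      using 4 opposite_not_adj edge_sym by (auto simp: edge_nbrs_def insert_commute)
  next
    case 5
    then show ?thesis
      using adj_single_edge assms edge_commute by (auto simp: edge_nbrs_def)
  qed
qed

end

text \<open>
  Far edges give every vertex of the polytope except the origin more than \<open>d\<close> neighbours; the last
  condition makes the vertex of an edge recognisable from its position relative to the unit vectors.
\<close>
locale skeleton_rigid_graph = nat_graph +
  assumes far_from_vertex: "u < d \<Longrightarrow> \<exists>w x. E w x \<and> w \<noteq> u \<and> x \<noteq> u \<and> \<not> E u w \<and> \<not> E u x"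
    and far_from_edge: "E u v \<Longrightarrow> \<exists>w x. E w x \<and> {w, x} \<inter> {u, v} = {} \<and> \<not> E w u \<and> \<not> E w v"
    and edge_nbrs_inject: "E u v \<Longrightarrow> E w x \<Longrightarrow> edge_nbrs E u v = edge_nbrs E w x \<Longrightarrow> {u, v} = {w, x}"
begin

text \<open>
  The map \<open>f\<close> exhibits \<open>d\<close> neighbours: where \<open>y\<close> itself is not adjacent to the vertex, the edge that
  blocks it is. The far edge is one neighbour more.
\<close>
lemma card_nbrs_single:
  assumes u: "u < d"
  shows "d < card (nbrs {u})"
proof -
  obtain w x where wx: "E w x" "w \<noteq> u" "x \<noteq> u" "\<not> E u w" "\<not> E u x"
    using far_from_vertex[OF u] by blast
  define f where "f y = (if y = u then {} else if E u y then {u, y} else {y})" for y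
  show ?thesis
  proof (rule card_nbrs_gt[of f "{u}" "{w, x}"])
    show "inj_on f {..<d}"
      by (auto simp: inj_on_def f_def doubleton_eq_iff split: if_splits)
    show "adj {u} (f y)" if "y < d" for y
      using that u adj_commute[of "{u}" "{}"] adj_empty_single adj_single_edge_incident adj_single_single
      by (auto simp: f_def)
    show "adj {u} {w, x}"
      using adj_single_edge[OF u wx(1)] wx by blast
    show "{w, x} \<notin> f ` {..<d}"
      using wx edge_irrefl by (auto simp: f_def doubleton_eq_iff split: if_splits)
  qed
qed

lemma card_nbrs_edge:
  assumes uv: "E u v"
  shows "d < card (nbrs {u, v})"
proof -
  obtain w x where wx: "E w x" "{w, x} \<inter> {u, v} = {}" "\<not> E w u" "\<not> E w v"
    using far_from_edge[OF uv] by blast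
  have "u \<noteq> v" "w \<noteq> x"
    using uv wx edge_irrefl by blast+
  define f where "f y = (if y = u \<or> y = v then {y} else if E u y then {u, y} else if E v y then {v, y}
    else {y})" for y
  show ?thesis
  proof (rule card_nbrs_gt[of f "{u, v}" "{w, x}"])
    show "inj_on f {..<d}"
    proof (rule inj_onI)
      fix y z assume "f y = f z"
      then show "y = z"
        by (auto simp: f_def doubleton_eq_iff split: if_splits)
    qed
    show "adj {u, v} (f y)" if "y < d" for y
    proof -
      consider "y = u" | "y = v" | "y \<noteq> u" "y \<noteq> v" "E u y" | "y \<noteq> u" "y \<noteq> v" "\<not> E u y" "E v y"
        | "y \<noteq> u" "y \<noteq> v" "\<not> E u y" "\<not> E v y"
        by blast
      then show ?thesis
      proof cases
        case 1
        then show ?thesis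
          using adj_single_edge_incident[OF uv] adj_commute by (simp add: f_def)
      next
        case 2
        then show ?thesis
          using adj_single_edge_incident[OF edge_sym[OF uv]] adj_commute
          by (simp add: f_def insert_commute)
      next
        case 3
        then show ?thesis
          using adj_edge_edge_incident[OF uv, of y] by (simp add: f_def)
      next
        case 4
        then show ?thesis
          using adj_edge_edge_incident[OF edge_sym[OF uv], of y] by (simp add: f_def insert_commute)
      next
        case 5
        then show ?thesis
          using adj_single_edge_iff[OF that uv] adj_commute by (simp add: f_def edge_nbrs_def)
      qed
    qed
    show "adj {u, v} {w, x}"
      using adj_edge_edge[OF uv wx] .
    show "{w, x} \<notin> f ` {..<d}"
      using wx \<open>w \<noteq> x\<close> by (auto simp: f_def doubleton_eq_iff split: if_splits)
  qed
qed

text \<open>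
  The reconstruction of the graph: the origin is the only vertex with as few as \<open>d\<close> neighbours, these
  neighbours are the nodes, and nodes locate edges.
\<close>
lemma graph_aut_of_cell_bijection:
  assumes bij: "bij_betw g cells cells"
    and adj: "\<And>S T. S \<in> cells \<Longrightarrow> T \<in> cells \<Longrightarrow> adj (g S) (g T) \<longleftrightarrow> adj S T"
  shows "\<exists>\<tau>\<in>graph_auts d E. \<forall>S\<in>cells. g S = \<tau> ` S"
proof -
  have gc: "g S \<in> cells" if "S \<in> cells" for S
    using bij that by (auto simp: bij_betw_def)
  have inj: "S = T" if "g S = g T" "S \<in> cells" "T \<in> cells" for S T
    using bij that by (auto simp: bij_betw_def dest: inj_onD)
  have nbrs: "nbrs (g S) = g ` nbrs S" if S: "S \<in> cells" for S
  proof
    show "g ` nbrs S \<subseteq> nbrs (g S)"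
      using S adj adj_cells by (auto simp: nbrs_def)
    show "nbrs (g S) \<subseteq> g ` nbrs S"
    proof
      fix T assume T: "T \<in> nbrs (g S)"
      then have "T \<in> cells"
        using adj_cells by (auto simp: nbrs_def)
      then obtain T' where "T' \<in> cells" "T = g T'"
        using bij by (auto simp: bij_betw_def)
      then show "T \<in> g ` nbrs S"
        using T S adj by (auto simp: nbrs_def)
    qed
  qed
  have "card (nbrs (g {})) \<le> d"
    using nbrs[OF empty_cell] card_image_le[OF finite_nbrs, of g "{}"] card_nbrs_empty by simp
  with gc[OF empty_cell] have g_empty: "g {} = {}"
    by (cases rule: cells_cases) (use card_nbrs_single card_nbrs_edge in fastforce)+
  have "\<exists>v<d. g {u} = {v}" if "u < d" for u
  proof -
    have "g ` nbrs {} = nbrs {}"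
      using nbrs[OF empty_cell] by (simp add: g_empty)
    moreover have "{u} \<in> nbrs {}"
      using that by (simp add: nbrs_empty)
    ultimately have "g {u} \<in> nbrs {}"
      by blast
    then show ?thesis
      by (auto simp: nbrs_empty)
  qed
  then obtain t where t: "t u < d" "g {u} = {t u}" if "u < d" for u
    by metis
  have t_inj: "u = v" if "t u = t v" "u < d" "v < d" for u v
    using inj[of "{u}" "{v}"] t that single_cell by simp
  define \<tau> where "\<tau> i = (if i < d then t i else i)" for i
  have \<tau>: "\<tau> permutes {..<d}"
  proof (rule bij_imp_permutes)
    have "inj_on \<tau> {..<d}"
      using t_inj by (auto simp: inj_on_def \<tau>_def)
    moreover have "\<tau> ` {..<d} \<subseteq> {..<d}"
      using t by (auto simp: \<tau>_def)
    ultimately show "bij_betw \<tau> {..<d} {..<d}"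
      by (simp add: bij_betw_def endo_inj_surj)
  qed (simp add: \<tau>_def)
  have \<tau>_lt: "\<tau> u < d" and g_single: "g {u} = {\<tau> u}" if "u < d" for u
    using t that by (auto simp: \<tau>_def)
  have \<tau>_inj: "\<tau> u = \<tau> v \<longleftrightarrow> u = v" for u v
    using permutes_inj[OF \<tau>] by (auto simp: inj_def)
  have single_iff: "adj {u} {v} \<longleftrightarrow> u \<noteq> v \<and> \<not> E u v" if "u < d" "v < d" for u v
    using that adj_single_single adj_cells opposite_single_single opposite_not_adj by blast
  have E: "E (\<tau> u) (\<tau> v) \<longleftrightarrow> E u v" if uv: "u < d" "v < d" for u v
    using adj[OF single_cell[OF uv(1)] single_cell[OF uv(2)]] uv \<tau>_lt edge_irrefl
    by (cases "u = v") (auto simp: g_single single_iff \<tau>_inj)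
  have g_edge: "g {u, v} = {\<tau> u, \<tau> v}" if uv: "E u v" for u v
  proof -
    have lt: "u < d" "v < d" and "u \<noteq> v"
      using uv edge_less edge_less2 edge_irrefl by blast+
    have uv_cell: "{u, v} \<in> cells"
      using uv by (rule edge_cell)
    from gc[OF uv_cell] obtain w x where wx: "E w x" "g {u, v} = {w, x}"
    proof (cases rule: cells_cases)
      case 1
      then have "{u, v} = {}"
        using inj g_empty uv_cell empty_cell by metis
      then show ?thesis by simp
    next
      case (2 y)
      then obtain z where "z < d" "\<tau> z = y"
        using permutes_image[OF \<tau>] by (metis imageE lessThan_iff)
      then have "{u, v} = {z}"
        using inj[of "{u, v}" "{z}"] 2 uv_cell single_cell g_single by simp
      then show ?thesis using \<open>u \<noteq> v\<close> by auto
    qed (use that in blast)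
    have "y \<in> edge_nbrs E w x \<longleftrightarrow> y \<in> edge_nbrs E (\<tau> u) (\<tau> v)" for y
    proof (cases "y < d")
      case True
      then obtain z where z: "z < d" "\<tau> z = y"
        using permutes_image[OF \<tau>] by (metis imageE lessThan_iff)
      have "y \<notin> edge_nbrs E w x \<longleftrightarrow> adj {y} {w, x}"
        using adj_single_edge_iff[OF True wx(1)] by simp
      also have "\<dots> \<longleftrightarrow> adj {z} {u, v}"
        using adj[OF single_cell[OF z(1)] uv_cell] wx(2) z g_single by simp
      also have "\<dots> \<longleftrightarrow> z \<notin> edge_nbrs E u v"
        using adj_single_edge_iff[OF z(1) uv] by simp
      also have "\<dots> \<longleftrightarrow> y \<notin> edge_nbrs E (\<tau> u) (\<tau> v)"
        using z lt E \<tau>_inj by (auto simp: edge_nbrs_def)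
      finally show ?thesis by blast
    next
      case False
      then show ?thesis
        using edge_less2 by (auto simp: edge_nbrs_def)
    qed
    then have "edge_nbrs E w x = edge_nbrs E (\<tau> u) (\<tau> v)"
      by blast
    then show ?thesis
      using edge_nbrs_inject[OF wx(1), of "\<tau> u" "\<tau> v"] E[OF lt] uv wx(2) by simp
  qed
  have "g S = \<tau> ` S" if "S \<in> cells" for S
    using that by (cases rule: cells_cases) (use g_empty g_single g_edge in auto)
  then show ?thesis
    using \<tau> E by (auto simp: graph_auts_def)
qed

lemma skeleton_aut_is_graph_aut:
  assumes f: "f \<in> skeleton_auts P"
  shows "\<exists>\<tau>\<in>graph_auts d E. f = restrict (permute_coords \<tau>) (vertices P)"
proof -
  have bij: "bij_betw f (vertices P) (vertices P)" and ext: "f \<in> extensional (vertices P)"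
    using f by (auto simp: skeleton_auts_def Bij_def)
  define g where "g S = {i. f (indicator S) i = 1}" for S
  have g: "f (indicator S) = indicator (g S)" "g S \<in> cells" if "S \<in> cells" for S
  proof -
    have "f (indicator S) \<in> vertices P"
      using bij that by (auto simp: bij_betw_def vertices_eq)
    then obtain T where T: "T \<in> cells" "f (indicator S) = indicator T"
      by (auto simp: vertices_eq)
    then have "g S = T"
      by (auto simp: g_def indicator_def split: if_splits)
    then show "f (indicator S) = indicator (g S)" "g S \<in> cells"
      using T by auto
  qed
  have "inj_on g cells"
  proof (rule inj_onI)
    fix S T assume ST: "S \<in> cells" "T \<in> cells" "g S = g T"
    then have "f (indicator S) = f (indicator T)"
      using g by simp
    then have "(indicator S :: nat \<Rightarrow> real) = indicator T"
      using bij ST by (auto simp: bij_betw_def vertices_eq dest: inj_onD)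
    then show "S = T"
      by (simp add: indicator_inject)
  qed
  moreover have "g ` cells \<subseteq> cells"
    using g by blast
  ultimately have "bij_betw g cells cells"
    using finite_family by (simp add: bij_betw_def endo_inj_surj)
  moreover have "adj (g S) (g T) \<longleftrightarrow> adj S T" if "S \<in> cells" "T \<in> cells" for S T
  proof -
    have "adjacent P (f (indicator S)) (f (indicator T)) \<longleftrightarrow> adjacent P (indicator S) (indicator T)"
      using f that by (simp add: skeleton_auts_def vertices_eq)
    then show ?thesis
      using that by (simp add: adj_def g(1))
  qed
  ultimately obtain \<tau> where \<tau>: "\<tau> \<in> graph_auts d E" "\<forall>S\<in>cells. g S = \<tau> ` S"
    using graph_aut_of_cell_bijection by blast
  then have "bij \<tau>"
    by (auto simp: graph_auts_def intro: permutes_bij)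
  have "f v = restrict (permute_coords \<tau>) (vertices P) v" for v
  proof (cases "v \<in> vertices P")
    case True
    then show ?thesis
      using g(1) \<tau>(2) permute_coords_indicator[OF \<open>bij \<tau>\<close>] by (auto simp: vertices_eq)
  next
    case False
    then show ?thesis
      using ext by (simp add: extensional_def)
  qed
  then show ?thesis
    using \<tau>(1) by blast
qed

lemma skeleton_auts_subset_comb_auts: "skeleton_auts P \<subseteq> comb_auts P"
  using skeleton_aut_is_graph_aut graph_aut_comb_aut by blast

lemma comb_auts_eq: "comb_auts P = (\<lambda>\<tau>. restrict (permute_coords \<tau>) (vertices P)) ` graph_auts d E"
  using comb_auts_subset_skeleton_auts[OF finite_vertices P_eq_hull_vertices]
    skeleton_aut_is_graph_aut graph_aut_comb_aut by blast

lemma comb_aut_isometry: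
  "f \<in> comb_auts P \<Longrightarrow> \<exists>g\<in>isometries_of d P. \<forall>v\<in>vertices P. f v = g v"
  using graph_aut_isometry by (auto simp: comb_auts_eq)

lemma comb_aut_group_iso:
  assumes G: "group G"
    and bij: "bij_betw \<Psi> (carrier G) (graph_auts d E)"
    and mult: "\<And>x y. x \<in> carrier G \<Longrightarrow> y \<in> carrier G \<Longrightarrow> \<Psi> (x \<otimes>\<^bsub>G\<^esub> y) = \<Psi> x \<circ> \<Psi> y"
  shows "comb_aut_group P \<cong> G"
proof -
  define \<Phi> where "\<Phi> x = restrict (permute_coords (\<Psi> x)) (vertices P)" for x
  have \<Psi>: "\<Psi> x \<in> graph_auts d E" if "x \<in> carrier G" for x
    using bij that by (auto simp: bij_betw_def)
  then have \<Psi>_bij: "bij (\<Psi> x)" if "x \<in> carrier G" for x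
    using that by (auto simp: graph_auts_def intro: permutes_bij)
  have inj: "inj_on \<Phi> (carrier G)"
  proof (rule inj_onI)
    fix x y assume xy: "x \<in> carrier G" "y \<in> carrier G" "\<Phi> x = \<Phi> y"
    then have "\<Psi> x = \<Psi> y"
      using permute_coords_vertices_inject \<Psi> by (simp add: \<Phi>_def)
    then show "x = y"
      using bij xy by (auto simp: bij_betw_def dest: inj_onD)
  qed
  have img: "\<Phi> ` carrier G = comb_auts P"
  proof -
    have "\<Phi> ` carrier G = (\<lambda>\<tau>. restrict (permute_coords \<tau>) (vertices P)) ` \<Psi> ` carrier G"
      unfolding \<Phi>_def image_image ..
    also have "\<Psi> ` carrier G = graph_auts d E"
      using bij by (simp add: bij_betw_def)
    finally show ?thesis
      unfolding comb_auts_eq .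
  qed
  have Bij: "\<Phi> x \<in> Bij (vertices P)" if "x \<in> carrier G" for x
    using img that by (auto simp: comb_auts_def)
  have "\<Phi> (x \<otimes>\<^bsub>G\<^esub> y) = compose (vertices P) (\<Phi> x) (\<Phi> y)"
    if "x \<in> carrier G" "y \<in> carrier G" for x y
  proof
    fix v
    show "\<Phi> (x \<otimes>\<^bsub>G\<^esub> y) v = compose (vertices P) (\<Phi> x) (\<Phi> y) v"
    proof (cases "v \<in> vertices P")
      case True
      then have "permute_coords (\<Psi> y) v \<in> vertices P"
        using Bij[OF that(2)] by (auto simp: Bij_def \<Phi>_def bij_betw_def)
      then show ?thesis
        using True mult[OF that] permute_coords_comp[OF \<Psi>_bij[OF that(1)] \<Psi>_bij[OF that(2)], of v]
        by (simp add: \<Phi>_def compose_def)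
    next
      case False
      then show ?thesis
        by (simp add: \<Phi>_def compose_def)
    qed
  qed
  then have "\<Phi> \<in> iso G (comb_aut_group P)"
    using img inj Bij
    by (auto simp: iso_def hom_def bij_betw_def comb_aut_group_def BijGroup_def)
  then show ?thesis
    using group.iso_sym[OF G] by (auto simp: is_iso_def)
qed

end

section \<open>A graph with a prescribed group of automorphisms\<close>

text \<open>The nontrivial elements of the group are numbered, to serve as labels of edges.\<close>
locale labelled_group = group G for G (structure) +
  fixes r :: nat and h :: "nat \<Rightarrow> 'a"
  assumes label: "bij_betw h {..<r} (carrier G - {\<one>})"
begin

definition m :: nat
  where "m = 4 * r"

definition V :: "('a \<times> nat) set"
  where "V = carrier G \<times> {..<2 * m}"

text \<open>
  Layers below \<open>m\<close> carry the main nodes, and \<open>(g, m + i)\<close> is the leaf attached to \<open>(g, i)\<close>. The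
  clauses are the half graph inside a copy, the leaves, and the labelled edges between layers
  \<open>2 r + 2 c\<close> and \<open>2 r + 2 c + 1\<close> for the label \<open>h c\<close>. Each edge is an arc towards the higher layer.
\<close>
fun arc :: "'a \<times> nat \<Rightarrow> 'a \<times> nat \<Rightarrow> bool"
  where "arc (g, i) (k, j) \<longleftrightarrow>
    g = k \<and> i < j \<and> j < m \<and> m \<le> Suc (i + j) \<or>
    g = k \<and> i < m \<and> j = m + i \<or>
    even i \<and> 2 * r \<le> i \<and> i < m \<and> j = Suc i \<and> k = g \<otimes> h ((i - 2 * r) div 2)"

definition joined :: "'a \<times> nat \<Rightarrow> 'a \<times> nat \<Rightarrow> bool"
  where "joined u v \<longleftrightarrow> u \<in> V \<and> v \<in> V \<and> (arc u v \<or> arc v u)"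

definition nbhd :: "'a \<times> nat \<Rightarrow> ('a \<times> nat) set"
  where "nbhd u = {v. joined u v}"

lemma label_closed: "k < r \<Longrightarrow> h k \<in> carrier G" and label_neq_one: "k < r \<Longrightarrow> h k \<noteq> \<one>"
  using label by (auto simp: bij_betw_def)

lemma label_index: "2 * r \<le> i \<Longrightarrow> i < m \<Longrightarrow> (i - 2 * r) div 2 < r"
  by (auto simp: m_def)

lemma mult_label_neq: "g \<in> carrier G \<Longrightarrow> k < r \<Longrightarrow> g \<otimes> h k \<noteq> g"
  by (simp add: label_closed label_neq_one)

lemma joined_sym: "joined u v \<Longrightarrow> joined v u"
  by (auto simp: joined_def)

lemma joined_V: "joined u v \<Longrightarrow> u \<in> V" "joined u v \<Longrightarrow> v \<in> V"
  by (auto simp: joined_def)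

lemma arc_less: "arc u v \<Longrightarrow> snd u < snd v"
  by (cases u; cases v) auto

lemma joined_snd_neq: "joined u v \<Longrightarrow> snd u \<noteq> snd v"
  using arc_less[of u v] arc_less[of v u] by (auto simp: joined_def)

lemma joined_leaf_iff:
  assumes "g \<in> carrier G" "i < m"
  shows "joined (g, m + i) u \<longleftrightarrow> u = (g, i)"
proof -
  have "Suc b < m" if "even b" "b < m" for b
    using that unfolding m_def by presburger
  then show ?thesis
    using assms by (cases u) (fastforce simp: joined_def V_def)
qed

text \<open>
  Labelled edges run between layers of the upper half only, so below it the half graph links
  corresponding elements and nothing else.
\<close>
lemma joined_low_iff:
  assumes "g \<in> carrier G" "k \<in> carrier G" "i < 2 * r" "i \<noteq> j" "j < m" "m \<le> Suc (i + j)"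
  shows "joined (g, i) (k, j) \<longleftrightarrow> g = k"
  using assms by (auto simp: joined_def V_def m_def)

lemma joined_label_iff:
  assumes "g \<in> carrier G" "k \<in> carrier G" "c < r"
  shows "joined (g, 2 * r + 2 * c) (k, Suc (2 * r + 2 * c)) \<longleftrightarrow> k = g \<or> k = g \<otimes> h c"
  using assms by (auto simp: joined_def V_def m_def)

lemma nbhd_main:
  assumes g: "g \<in> carrier G" and i: "i < m"
  shows "nbhd (g, i) = {g} \<times> ({m - Suc i..<m} - {i}) \<union> {(g, m + i)} \<union>
    (if i < 2 * r then {} else if even i then {(g \<otimes> h ((i - 2 * r) div 2), Suc i)}
     else {(g \<otimes> m_inv G (h ((i - 2 * r) div 2)), i - 1)})" (is "_ = ?A \<union> ?B \<union> ?C")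
proof -
  have "joined (g, i) (k, j) \<longleftrightarrow> (k, j) \<in> ?A \<union> ?B \<union> ?C" for k j
  proof -
    have m_even: "even m"
      by (simp add: m_def)
    have inner: "(k, j) \<in> ?A \<longleftrightarrow> g = k \<and> j < m \<and> i \<noteq> j \<and> m \<le> Suc (i + j)"
      using i by auto
    have up: "(k, j) \<in> V \<and> even i \<and> 2 * r \<le> i \<and> i < m \<and> j = Suc i \<and> k = g \<otimes> h ((i - 2 * r) div 2)
      \<longleftrightarrow> \<not> i < 2 * r \<and> even i \<and> (k, j) = (g \<otimes> h ((i - 2 * r) div 2), Suc i)"
      using i g label_closed[OF label_index[of i]] by (auto simp: V_def)
    have down: "(k, j) \<in> V \<and> even j \<and> 2 * r \<le> j \<and> j < m \<and> i = Suc j \<and> g = k \<otimes> h ((j - 2 * r) div 2)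
      \<longleftrightarrow> \<not> i < 2 * r \<and> odd i \<and> (k, j) = (g \<otimes> m_inv G (h ((i - 2 * r) div 2)), i - 1)" (is "?L \<longleftrightarrow> ?R")
    proof
      assume L: ?L
      then have "2 * r \<le> j" "even j" "i = Suc j"
        by auto
      then have idx: "(i - 2 * r) div 2 = (j - 2 * r) div 2"
        by presburger
      have "h ((j - 2 * r) div 2) \<in> carrier G" "k \<in> carrier G"
        using L label_closed label_index by (auto simp: V_def)
      then show ?R
        using L idx g by (auto simp: m_assoc)
    next
      assume R: ?R
      then have odd: "2 * r \<le> i" "odd i" and j: "j = i - 1"
        by auto
      then have bounds: "2 * r \<le> j" "even j" "i = Suc j" and idx: "(i - 2 * r) div 2 = (j - 2 * r) div 2"
        by presburger+
      have "h ((i - 2 * r) div 2) \<in> carrier G"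
        using label_closed label_index odd(1) i by blast
      then show ?L
        using R bounds idx g i by (auto simp: V_def m_assoc)
    qed
    have "joined (g, i) (k, j) \<longleftrightarrow> (g = k \<and> j < m \<and> i \<noteq> j \<and> m \<le> Suc (i + j)) \<or> (g = k \<and> j = m + i) \<or>
      ((k, j) \<in> V \<and> even i \<and> 2 * r \<le> i \<and> i < m \<and> j = Suc i \<and> k = g \<otimes> h ((i - 2 * r) div 2)) \<or>
      ((k, j) \<in> V \<and> even j \<and> 2 * r \<le> j \<and> j < m \<and> i = Suc j \<and> g = k \<otimes> h ((j - 2 * r) div 2))"
      using g i by (auto simp: joined_def V_def)
    also have "\<dots> \<longleftrightarrow> (k, j) \<in> ?A \<union> ?B \<union> ?C"
      unfolding up down inner by auto
    finally show ?thesis .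
  qed
  then show ?thesis
    by (auto simp: nbhd_def)
qed

lemma nbhd_leaf:
  assumes "g \<in> carrier G" "i < m"
  shows "nbhd (g, m + i) = {(g, i)}"
  using joined_leaf_iff[OF assms] by (auto simp: nbhd_def)

text \<open>
  For \<open>i < 2 r\<close> the half graph contributes \<open>i + 1\<close> neighbours; from \<open>i = 2 r\<close> on the index \<open>i\<close> itself has
  to be left out and the labelled edge makes up for it. The leaf is the last neighbour. Labels
  different from \<open>1\<close> ensure that the labelled edge leaves the copy.
\<close>
lemma card_nbhd_main:
  assumes g: "g \<in> carrier G" and i: "i < m"
  shows "card (nbhd (g, i)) = i + 2"
proof -
  define A where "A = {g} \<times> ({m - Suc i..<m} - {i})"
  define C where "C = (if i < 2 * r then {} else if even i then {(g \<otimes> h ((i - 2 * r) div 2), Suc i)}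
     else {(g \<otimes> m_inv G (h ((i - 2 * r) div 2)), i - 1)})"
  have "g \<otimes> h ((i - 2 * r) div 2) \<noteq> g" "g \<otimes> m_inv G (h ((i - 2 * r) div 2)) \<noteq> g" if "\<not> i < 2 * r"
  proof -
    have c: "(i - 2 * r) div 2 < r"
      using label_index that i by simp
    then show "g \<otimes> h ((i - 2 * r) div 2) \<noteq> g"
      using mult_label_neq g by blast
    show "g \<otimes> m_inv G (h ((i - 2 * r) div 2)) \<noteq> g"
      using label_closed[OF c] label_neq_one[OF c] g by (simp add: inv_eq_1_iff)
  qed
  then have disj: "A \<inter> {(g, m + i)} = {}" "(A \<union> {(g, m + i)}) \<inter> C = {}"
    by (auto simp: A_def C_def)
  have "card {m - Suc i..<m} = Suc i"
    using i by auto
  moreover have "i \<in> {m - Suc i..<m} \<longleftrightarrow> 2 * r \<le> i"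
    using i by (auto simp: m_def)
  ultimately have cardA: "card A = (if 2 * r \<le> i then i else Suc i)"
    by (auto simp: A_def card_cartesian_product card_Diff_singleton_if)
  have cardC: "card C = (if 2 * r \<le> i then 1 else 0)"
    by (auto simp: C_def)
  have fin: "finite A" "finite C"
    by (auto simp: A_def C_def)
  have "nbhd (g, i) = A \<union> {(g, m + i)} \<union> C"
    using nbhd_main[OF assms] by (simp only: A_def C_def)
  then show ?thesis
    using disj fin cardA cardC by (simp add: card_Un_disjoint del: Un_insert_right)
qed

lemma V_cases:
  assumes "u \<in> V"
  obtains g i where "g \<in> carrier G" "i < m" "u = (g, i)" | g i where "g \<in> carrier G" "i < m" "u = (g, m + i)"
proof -
  obtain g j where u: "u = (g, j)" "g \<in> carrier G" "j < 2 * m"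
    using assms by (auto simp: V_def)
  show ?thesis
  proof (cases "j < m")
    case False
    then have "u = (g, m + (j - m))" "j - m < m"
      using u by auto
    then show ?thesis using that(2) u(2) by blast
  qed (use that(1) u in blast)
qed

lemma main_V: "g \<in> carrier G \<Longrightarrow> i < m \<Longrightarrow> (g, i) \<in> V"
  and leaf_V: "g \<in> carrier G \<Longrightarrow> i < m \<Longrightarrow> (g, m + i) \<in> V"
  by (auto simp: V_def)

lemma joined_translate_iff:
  assumes x: "x \<in> carrier G" and u: "(g, i) \<in> V" and v: "(k, j) \<in> V"
  shows "joined (x \<otimes> g, i) (x \<otimes> k, j) \<longleftrightarrow> joined (g, i) (k, j)"
proof -
  have gk: "g \<in> carrier G" "k \<in> carrier G"
    using u v by (auto simp: V_def)
  have arc: "arc (x \<otimes> a, i) (x \<otimes> b, j) \<longleftrightarrow> arc (a, i) (b, j)"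
    if ab: "a \<in> carrier G" "b \<in> carrier G" for a b i j
  proof (cases "2 * r \<le> i \<and> i < m")
    case True
    then have "h ((i - 2 * r) div 2) \<in> carrier G"
      using label_closed label_index by blast
    then have "x \<otimes> b = x \<otimes> a \<otimes> h ((i - 2 * r) div 2) \<longleftrightarrow> b = a \<otimes> h ((i - 2 * r) div 2)"
      using x ab by (simp add: m_assoc)
    then show ?thesis
      using x ab by simp
  next
    case False
    then show ?thesis
      using x ab by auto
  qed
  show ?thesis
    using x gk arc[OF gk] arc[OF gk(2,1)] by (auto simp: joined_def V_def)
qed

text \<open>
  Degrees fix the layers. On each layer the automorphism acts by a map \<open>p i\<close> of the group; the edges
  of \<open>joined_low_iff\<close> from layer \<open>m - 1\<close> to the lower half, and from there to the upper half, show
  that all \<open>p i\<close> are the same map \<open>q\<close>. A labelled edge from \<open>1\<close> to \<open>g\<close> then gives \<open>q g = q 1 g\<close>, the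
  alternative \<open>q g = q 1\<close> being excluded by injectivity.
\<close>
theorem automorphism_is_translation:
  assumes bij: "bij_betw \<phi> V V"
    and joined: "\<And>u v. u \<in> V \<Longrightarrow> v \<in> V \<Longrightarrow> joined (\<phi> u) (\<phi> v) \<longleftrightarrow> joined u v"
  shows "\<exists>x\<in>carrier G. \<forall>g i. (g, i) \<in> V \<longrightarrow> \<phi> (g, i) = (x \<otimes> g, i)"
proof (cases "r = 0")
  case True
  have "V = {}"
    unfolding V_def m_def using True by simp
  then show ?thesis
    by (intro bexI[of _ \<one>]) auto
next
  case False
  then have r: "0 < r" and m: "m - 1 < m" "2 * r < m" "0 < m"
    by (auto simp: m_def)
  have \<phi>V: "\<phi> u \<in> V" if "u \<in> V" for u
    using bij that by (auto simp: bij_betw_def)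
  have \<phi>_inj: "u = v" if "\<phi> u = \<phi> v" "u \<in> V" "v \<in> V" for u v
    using bij that by (auto simp: bij_betw_def dest: inj_onD)
  have card: "card (nbhd (\<phi> u)) = card (nbhd u)" if u: "u \<in> V" for u
  proof -
    have "nbhd (\<phi> u) = \<phi> ` nbhd u"
    proof
      show "\<phi> ` nbhd u \<subseteq> nbhd (\<phi> u)"
        using joined[OF u] joined_V(2)[of u] unfolding nbhd_def by blast
      show "nbhd (\<phi> u) \<subseteq> \<phi> ` nbhd u"
      proof
        fix v assume "v \<in> nbhd (\<phi> u)"
        then have v: "joined (\<phi> u) v" "v \<in> V"
          using joined_V by (auto simp: nbhd_def)
        then obtain w where "w \<in> V" "v = \<phi> w"
          using bij unfolding bij_betw_def by blast
        then show "v \<in> \<phi> ` nbhd u"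
          using v joined u by (auto simp: nbhd_def)
      qed
    qed
    moreover have "inj_on \<phi> (nbhd u)"
      using \<phi>_inj joined_V by (auto simp: inj_on_def nbhd_def)
    ultimately show ?thesis
      by (simp add: card_image)
  qed
  have main: "\<exists>k\<in>carrier G. \<phi> (g, i) = (k, i)" if gi: "g \<in> carrier G" "i < m" for g i
  proof -
    have "card (nbhd (\<phi> (g, i))) = i + 2"
      using card[OF main_V[OF gi]] card_nbhd_main[OF gi] by simp
    with \<phi>V[OF main_V[OF gi]] show ?thesis
      by (cases rule: V_cases) (auto simp: card_nbhd_main nbhd_leaf)
  qed
  have leaf: "\<exists>k\<in>carrier G. \<exists>j<m. \<phi> (g, m + i) = (k, m + j)" if gi: "g \<in> carrier G" "i < m" for g i
  proof -
    have "card (nbhd (\<phi> (g, m + i))) = 1"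
      using card[OF leaf_V[OF gi]] nbhd_leaf[OF gi] by simp
    with \<phi>V[OF leaf_V[OF gi]] show ?thesis
      by (cases rule: V_cases) (auto simp: card_nbhd_main)
  qed
  define p where "p i g = fst (\<phi> (g, i))" for i g
  have p: "\<phi> (g, i) = (p i g, i)" "p i g \<in> carrier G" if "g \<in> carrier G" "i < m" for g i
    using main[OF that] by (auto simp: p_def)
  have p_low: "p i g = p j g" if g: "g \<in> carrier G" and ij: "i < 2 * r" "i \<noteq> j" "j < m" "m \<le> Suc (i + j)" for g i j
  proof -
    have i: "i < m"
      using ij m by simp
    have "joined (g, i) (g, j)"
      using joined_low_iff[OF g g ij] by simp
    then have "joined (p i g, i) (p j g, j)"
      using joined[OF main_V[OF g i] main_V[OF g ij(3)]] p[OF g i] p[OF g ij(3)] by simp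
    then show ?thesis
      using joined_low_iff[OF p(2)[OF g i] p(2)[OF g ij(3)] ij] by simp
  qed
  have p_eq: "p i g = p (m - 1) g" if g: "g \<in> carrier G" and i: "i < m" for i g
  proof (cases "i < 2 * r")
    case True
    then show ?thesis
      using p_low[OF g True, of "m - 1"] m by simp
  next
    case False
    then have low: "m - Suc i < 2 * r"
      using i by (simp add: m_def)
    have "p (m - Suc i) g = p i g"
      using p_low[OF g low, of i] i False low by simp
    moreover have "p (m - Suc i) g = p (m - 1) g"
      using p_low[OF g low, of "m - 1"] m i low by simp
    ultimately show ?thesis
      by simp
  qed
  define q where "q = p (m - 1)"
  have q: "\<phi> (g, i) = (q g, i)" if "g \<in> carrier G" "i < m" for g i
    using p(1)[OF that] p_eq[OF that] unfolding q_def by metis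
  have qG: "q g \<in> carrier G" if "g \<in> carrier G" for g
    using p(2)[OF that m(1)] by (simp add: q_def)
  have q_inj: "a = b" if "q a = q b" "a \<in> carrier G" "b \<in> carrier G" for a b
    using \<phi>_inj[of "(a, 0)" "(b, 0)"] that q m main_V by simp
  have q_translate: "q g = q \<one> \<otimes> g" if g: "g \<in> carrier G" for g
  proof (cases "g = \<one>")
    case True
    then show ?thesis using qG by simp
  next
    case False
    then obtain c where c: "c < r" "g = h c"
      using label g by (metis DiffI bij_betw_imp_surj_on imageE lessThan_iff singletonD)
    let ?i = "2 * r + 2 * c"
    have i: "?i < m" "Suc ?i < m"
      using c(1) by (auto simp: m_def)
    have "joined (\<one>, ?i) (g, Suc ?i)"
      using joined_label_iff[OF one_closed g c(1)] c(2) g by simp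
    then have "joined (q \<one>, ?i) (q g, Suc ?i)"
      using joined[OF main_V[OF one_closed i(1)] main_V[OF g i(2)]] q i g by simp
    then have "q g = q \<one> \<or> q g = q \<one> \<otimes> g"
      using joined_label_iff[OF qG qG c(1)] g c(2) by simp
    then show ?thesis
      using q_inj[OF _ g one_closed] False by blast
  qed
  have "\<phi> (g, i) = (q \<one> \<otimes> g, i)" if gi: "(g, i) \<in> V" for g i
    using gi
  proof (cases rule: V_cases)
    case (1 g' i')
    then show ?thesis
      using q[of g' i'] q_translate[of g'] by simp
  next
    case (2 k j)
    then obtain k' j' where k'j': "k' \<in> carrier G" "j' < m" "\<phi> (g, i) = (k', m + j')"
      using leaf[OF 2(1,2)] unfolding 2(3) by blast
    have "joined (k, m + j) (k, j)"
      using joined_leaf_iff 2 by simp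
    then have "joined (k', m + j') (q k, j)"
      using joined[OF leaf_V main_V, of k j k j] 2 k'j' q by simp
    then have "k' = q k" "j' = j"
      using joined_leaf_iff k'j' by auto
    then show ?thesis
      using 2 k'j' q_translate[of k] by simp
  qed
  then show ?thesis
    using qG by blast
qed

text \<open>The pendant edge at another node of the same layer is far away.\<close>
lemma far_from_vertex:
  assumes "u \<in> V"
  shows "\<exists>w x. joined w x \<and> w \<noteq> u \<and> x \<noteq> u \<and> \<not> joined u w \<and> \<not> joined u x"
proof -
  obtain g i where gi: "g \<in> carrier G" "i < m" "u = (g, i) \<or> u = (g, m + i)"
    using assms by (cases rule: V_cases) auto
  then have r: "0 < r"
    by (simp add: m_def)
  define k where "k = g \<otimes> h 0"
  have k: "k \<in> carrier G" "k \<noteq> g"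
    using gi r label_closed mult_label_neq by (auto simp: k_def)
  have "\<not> joined (g, i) (k, i)"
    using joined_snd_neq by fastforce
  moreover have "\<not> joined (k, m + i) (g, i)" "\<not> joined (k, m + i) (g, m + i)" "\<not> joined (g, m + i) (k, i)"
    "joined (k, m + i) (k, i)"
    using joined_leaf_iff gi k by auto
  ultimately show ?thesis
    using gi k by (intro exI[of _ "(k, m + i)"] exI[of _ "(k, i)"]) (auto dest: joined_sym)
qed

text \<open>
  A leaf is far from every edge that avoids its main node, and three main nodes of a copy cannot all
  lie on one edge.
\<close>
lemma far_from_edge:
  assumes uv: "joined u v"
  shows "\<exists>w x. joined w x \<and> {w, x} \<inter> {u, v} = {} \<and> \<not> joined w u \<and> \<not> joined w v"
proof -
  obtain g where g: "g \<in> carrier G" and r: "0 < r"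
    using joined_V(1)[OF uv] by (cases rule: V_cases) (auto simp: m_def)
  have "\<exists>c<3. c \<noteq> snd u \<and> c \<noteq> snd v"
    by presburger
  then obtain c where "c < 3" "c \<noteq> snd u" "c \<noteq> snd v"
    by blast
  then have c: "c < m" "(g, c) \<noteq> u" "(g, c) \<noteq> v"
    using r by (auto simp: m_def)
  have leaf: "joined (g, m + c) y \<longleftrightarrow> y = (g, c)" for y
    using joined_leaf_iff[OF g c(1)] .
  then have "(g, m + c) \<noteq> u" "(g, m + c) \<noteq> v"
    using uv joined_sym[OF uv] c(2,3) by metis+
  then show ?thesis
    using leaf c by (intro exI[of _ "(g, m + c)"] exI[of _ "(g, c)"]) auto
qed

lemma edge_cases:
  assumes uv: "joined u v"
  obtains "snd u < m" "snd v < m" | g i where "g \<in> carrier G" "i < m" "{u, v} = {(g, i), (g, m + i)}"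
    "edge_nbrs joined u v = nbhd (g, i) - {(g, m + i)}"
proof -
  note edge_case = that
  have pendant: ?thesis if gi: "g \<in> carrier G" "i < m" "{u, v} = {(g, i), (g, m + i)}" for g i
  proof (rule edge_case(2)[OF gi])
    have "u = (g, i) \<and> v = (g, m + i) \<or> v = (g, i) \<and> u = (g, m + i)"
      using gi(3) by (auto simp: doubleton_eq_iff)
    moreover have "\<not> joined (g, i) (g, i)"
      using joined_snd_neq by fastforce
    ultimately show "edge_nbrs joined u v = nbhd (g, i) - {(g, m + i)}"
      using joined_leaf_iff[OF gi(1,2)] by (auto simp: edge_nbrs_def nbhd_def)
  qed
  from joined_V(1)[OF uv] show ?thesis
  proof (cases rule: V_cases)
    case u: (1 g i)
    from joined_V(2)[OF uv] show ?thesis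
    proof (cases rule: V_cases)
      case (1 k j)
      then show ?thesis using edge_case(1) u by simp
    next
      case (2 k j)
      then show ?thesis
        using joined_sym[OF uv] joined_leaf_iff[of k j u] pendant[of k j] by auto
    qed
  next
    case (2 g i)
    then show ?thesis
      using uv joined_leaf_iff[of g i v] pendant[of g i] by auto
  qed
qed

lemma leaf_in_edge_nbrs_iff:
  assumes "joined u v" "g \<in> carrier G" "i < m"
  shows "(g, m + i) \<in> edge_nbrs joined u v \<longleftrightarrow> (g, i) \<in> {u, v} \<and> (g, m + i) \<notin> {u, v}"
proof -
  have "joined y (g, m + i) \<longleftrightarrow> y = (g, i)" for y
    using joined_leaf_iff[OF assms(2,3)] joined_sym by blast
  then show ?thesis
    by (auto simp: edge_nbrs_def)
qed

text \<open>
  The leaves in the set reveal both ends of an edge between main nodes, and there are none for a pendant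
  edge. A pendant edge at \<open>(g, i)\<close> shows the remaining neighbours of \<open>(g, i)\<close>: their number gives \<open>i\<close>,
  and the one in layer \<open>m - 1 - i\<close> gives \<open>g\<close>.
\<close>
lemma edge_nbrs_inject:
  assumes uv: "joined u v" and wx: "joined w x" and eq: "edge_nbrs joined u v = edge_nbrs joined w x"
  shows "{u, v} = {w, x}"
proof -
  define leads where "leads u v = {(g, i). g \<in> carrier G \<and> i < m \<and> (g, m + i) \<in> edge_nbrs joined u v}" for u v
  have main: "leads u v = {u, v}" if "joined u v" "snd u < m" "snd v < m" for u v
  proof -
    have "y \<in> carrier G \<times> {..<m}" if "y \<in> {u, v}" for y
      using that joined_V[OF \<open>joined u v\<close>] \<open>snd u < m\<close> \<open>snd v < m\<close> by (auto simp: V_def)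
    then show ?thesis
      using leaf_in_edge_nbrs_iff[OF that(1)] that by (fastforce simp: leads_def)
  qed
  have pendant: "leads u v = {}" if "joined u v" "{u, v} = {(g, i), (g, m + i)}" for u v g i
    using leaf_in_edge_nbrs_iff[OF that(1)] by (auto simp: leads_def that(2))
  have leads: "leads u v = leads w x"
    by (simp add: leads_def eq)
  from uv show ?thesis
  proof (cases rule: edge_cases)
    case 1
    from wx show ?thesis
      by (cases rule: edge_cases) (use 1 main[OF uv] main[OF wx] pendant[OF wx] leads in auto)
  next
    case gi: (2 g i)
    from wx show ?thesis
    proof (cases rule: edge_cases)
      case 1
      then show ?thesis
        using main[OF wx] pendant[OF uv gi(3)] leads by simp
    next
      case kj: (2 k j)
      have nbhds: "nbhd (g, i) - {(g, m + i)} = nbhd (k, j) - {(k, m + j)}"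
        using eq gi(4) kj(4) by simp
      moreover have "card (nbhd (g, i) - {(g, m + i)}) = i + 1" if "g \<in> carrier G" "i < m" for g i
      proof -
        have "(g, m + i) \<in> nbhd (g, i)"
          using joined_leaf_iff[OF that] joined_sym by (auto simp: nbhd_def)
        then show ?thesis
          using card_nbhd_main[OF that] by (simp add: card_Diff_singleton)
      qed
      ultimately have ij: "i = j"
        using gi(1,2) kj(1,2) by (metis add_right_cancel)
      have low_iff: "joined (a, i) (b, m - Suc i) \<longleftrightarrow> a = b" if "a \<in> carrier G" "b \<in> carrier G" for a b
      proof (cases "i < 2 * r")
        case True
        then show ?thesis
          using joined_low_iff[OF that True, of "m - Suc i"] gi(2) by (auto simp: m_def)
      next
        case False
        then have "m - Suc i < 2 * r" "m - Suc i \<noteq> i" "m \<le> Suc (m - Suc i + i)"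
          using gi(2) by (auto simp: m_def)
        then show ?thesis
          using joined_low_iff[OF that(2,1), of "m - Suc i" i] gi(2) joined_sym by blast
      qed
      have "(g, m - Suc i) \<in> nbhd (g, i) - {(g, m + i)}"
        using low_iff gi(1,2) by (auto simp: nbhd_def)
      then have "joined (k, i) (g, m - Suc i)"
        unfolding nbhds ij[symmetric] by (simp add: nbhd_def)
      then have "k = g"
        using low_iff gi(1) kj(1) by simp
      then show ?thesis
        using gi(3) kj(3) ij by simp
    qed
  qed
qed

end

lemma (in labelled_group) finite_V: "finite (carrier G) \<Longrightarrow> finite V"
  by (simp add: V_def)

text \<open>
  The graph is transported along a numbering of its nodes. For the trivial group it is empty, and its
  automorphism group is trivial as well.
\<close>
lemma (in group) ex_group_graph:
  assumes fin: "finite (carrier G)"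
  shows "\<exists>d E \<Psi>. skeleton_rigid_graph d E \<and> bij_betw \<Psi> (carrier G) (graph_auts d E) \<and>
    (\<forall>x\<in>carrier G. \<forall>y\<in>carrier G. \<Psi> (x \<otimes> y) = \<Psi> x \<circ> \<Psi> y)"
proof -
  obtain r :: nat and h where "bij_betw h {..<r} (carrier G - {\<one>})"
    using ex_bij_betw_nat_finite[of "carrier G - {\<one>}"] fin by (auto simp: atLeast0LessThan)
  then interpret labelled_group G r h
    by unfold_locales
  define d where "d = card V"
  obtain \<pi> where \<pi>: "bij_betw \<pi> {..<d} V"
    using ex_bij_betw_nat_finite[OF finite_V[OF fin]] by (auto simp: atLeast0LessThan d_def)
  define \<nu> where "\<nu> = inv_into {..<d} \<pi>"
  have \<pi>V: "\<pi> a \<in> V" if "a < d" for a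
    using \<pi> that by (auto simp: bij_betw_def)
  have \<nu>: "\<nu> u < d" "\<pi> (\<nu> u) = u" if "u \<in> V" for u
    using bij_betw_inv_into[OF \<pi>] bij_betw_inv_into_right[OF \<pi>] that
    by (auto simp: \<nu>_def bij_betw_def)
  have \<nu>\<pi>: "\<nu> (\<pi> a) = a" if "a < d" for a
    using bij_betw_inv_into_left[OF \<pi>] that by (auto simp: \<nu>_def)
  have \<pi>_inj: "a = b" if "\<pi> a = \<pi> b" "a < d" "b < d" for a b
    using \<nu>\<pi> that by metis
  define E where "E a b \<longleftrightarrow> a < d \<and> b < d \<and> joined (\<pi> a) (\<pi> b)" for a b
  have E_\<nu>: "E (\<nu> u) (\<nu> v) \<longleftrightarrow> joined u v" if "u \<in> V" "v \<in> V" for u v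
    using \<nu> that by (simp add: E_def)

  interpret graph: skeleton_rigid_graph d E
  proof
    show "u < d" if "E u v" for u v
      using that by (simp add: E_def)
    show "E v u" if "E u v" for u v
      using that joined_sym by (simp add: E_def)
    show "\<not> E u u" for u
      using joined_snd_neq unfolding E_def by blast
  next
    fix a assume a: "a < d"
    obtain w x where wx: "joined w x" "w \<noteq> \<pi> a" "x \<noteq> \<pi> a" "\<not> joined (\<pi> a) w" "\<not> joined (\<pi> a) x"
      using far_from_vertex[OF \<pi>V[OF a]] by blast
    then have V: "w \<in> V" "x \<in> V"
      using joined_V by auto
    have "E (\<nu> w) (\<nu> x)" "\<nu> w \<noteq> a" "\<nu> x \<noteq> a" "\<not> E a (\<nu> w)" "\<not> E a (\<nu> x)"
      using wx \<nu>[OF V(1)] \<nu>[OF V(2)] by (auto simp: E_def)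
    then show "\<exists>w x. E w x \<and> w \<noteq> a \<and> x \<noteq> a \<and> \<not> E a w \<and> \<not> E a x"
      by blast
  next
    fix a b assume ab: "E a b"
    then obtain w x where wx: "joined w x" "{w, x} \<inter> {\<pi> a, \<pi> b} = {}" "\<not> joined w (\<pi> a)" "\<not> joined w (\<pi> b)"
      using far_from_edge[of "\<pi> a" "\<pi> b"] by (auto simp: E_def)
    then have V: "w \<in> V" "x \<in> V"
      using joined_V by auto
    have "E (\<nu> w) (\<nu> x)" "{\<nu> w, \<nu> x} \<inter> {a, b} = {}" "\<not> E (\<nu> w) a" "\<not> E (\<nu> w) b"
      using wx \<nu>[OF V(1)] \<nu>[OF V(2)] by (auto simp: E_def)
    then show "\<exists>w x. E w x \<and> {w, x} \<inter> {a, b} = {} \<and> \<not> E w a \<and> \<not> E w b"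
      by blast
  next
    fix a b c e assume E: "E a b" "E c e" and eq: "edge_nbrs E a b = edge_nbrs E c e"
    have image: "edge_nbrs joined (\<pi> a) (\<pi> b) = \<pi> ` edge_nbrs E a b" if "E a b" for a b
    proof
      show "\<pi> ` edge_nbrs E a b \<subseteq> edge_nbrs joined (\<pi> a) (\<pi> b)"
        using that \<pi>_inj by (auto simp: edge_nbrs_def E_def)
      show "edge_nbrs joined (\<pi> a) (\<pi> b) \<subseteq> \<pi> ` edge_nbrs E a b"
      proof
        fix y assume y: "y \<in> edge_nbrs joined (\<pi> a) (\<pi> b)"
        then have "y \<in> V"
          using joined_V(2) unfolding edge_nbrs_def by blast
        then have "y = \<pi> (\<nu> y)" "\<nu> y \<in> edge_nbrs E a b"
          using y that \<nu>[of y] by (auto simp: edge_nbrs_def E_def)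
        then show "y \<in> \<pi> ` edge_nbrs E a b"
          by blast
      qed
    qed
    have "{\<pi> a, \<pi> b} = {\<pi> c, \<pi> e}"
      using edge_nbrs_inject[of "\<pi> a" "\<pi> b" "\<pi> c" "\<pi> e"] image[OF E(1)] image[OF E(2)] eq E
      by (auto simp: E_def)
    then show "{a, b} = {c, e}"
      using \<pi>_inj E by (auto simp: doubleton_eq_iff E_def)
  qed

  define L where "L x u = (x \<otimes> fst u, snd u)" for x and u :: "'a \<times> nat"
  have L_V: "L x u \<in> V" if "x \<in> carrier G" "u \<in> V" for x u
    using that by (auto simp: L_def V_def)
  have L_mult: "L (x \<otimes> y) u = L x (L y u)" if "x \<in> carrier G" "y \<in> carrier G" "u \<in> V" for x y u
    using that by (auto simp: L_def V_def m_assoc)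
  have L_joined: "joined (L x u) (L x v) \<longleftrightarrow> joined u v" if "x \<in> carrier G" "u \<in> V" "v \<in> V" for x u v
    using joined_translate_iff[OF that(1), of "fst u" "snd u" "fst v" "snd v"] that by (simp add: L_def)
  have L_inj: "u = v" if "L x u = L x v" "x \<in> carrier G" "u \<in> V" "v \<in> V" for x u v
    using that by (auto simp: L_def V_def)
  define \<Psi> where "\<Psi> x i = (if i < d then \<nu> (L x (\<pi> i)) else i)" for x i
  have \<Psi>_lt: "\<Psi> x i < d" and \<pi>_\<Psi>: "\<pi> (\<Psi> x i) = L x (\<pi> i)" if "x \<in> carrier G" "i < d" for x i
    using that \<nu> L_V \<pi>V by (auto simp: \<Psi>_def)
  have "\<Psi> x \<in> graph_auts d E" if x: "x \<in> carrier G" for x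
  proof -
    have "inj_on (\<Psi> x) {..<d}"
      using \<pi>_\<Psi>[OF x] L_inj[OF _ x] \<pi>V \<pi>_inj by (metis inj_onI lessThan_iff)
    moreover have "\<Psi> x ` {..<d} \<subseteq> {..<d}"
      using \<Psi>_lt[OF x] by auto
    ultimately have "bij_betw (\<Psi> x) {..<d} {..<d}"
      by (simp add: bij_betw_def endo_inj_surj)
    then have "\<Psi> x permutes {..<d}"
      by (rule bij_imp_permutes) (simp add: \<Psi>_def)
    moreover have "E (\<Psi> x a) (\<Psi> x b) \<longleftrightarrow> E a b" if "a < d" "b < d" for a b
      using that \<Psi>_lt[OF x] \<pi>_\<Psi>[OF x] L_joined[OF x] \<pi>V by (simp add: E_def)
    ultimately show ?thesis
      by (simp add: graph_auts_def)
  qed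
  moreover have "inj_on \<Psi> (carrier G)"
  proof (cases "m = 0")
    case True
    then have "carrier G - {\<one>} = {}"
      using label by (simp add: m_def bij_betw_def)
    then show ?thesis
      by (auto simp: inj_on_def)
  next
    case False
    show ?thesis
    proof (rule inj_onI)
      fix x y assume xy: "x \<in> carrier G" "y \<in> carrier G" "\<Psi> x = \<Psi> y"
      have one: "(\<one>, 0) \<in> V"
        using main_V False by simp
      then have "L x (\<one>, 0) = L y (\<one>, 0)"
        using \<pi>_\<Psi>[OF xy(1) \<nu>(1)[OF one]] \<pi>_\<Psi>[OF xy(2) \<nu>(1)[OF one]] \<nu>(2)[OF one] xy(3) by simp
      then show "x = y"
        using xy by (simp add: L_def)
    qed
  qed
  moreover have "\<tau> \<in> \<Psi> ` carrier G" if \<tau>: "\<tau> \<in> graph_auts d E" for \<tau>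
  proof -
    have perm: "\<tau> permutes {..<d}" and \<tau>E: "a < d \<Longrightarrow> b < d \<Longrightarrow> E (\<tau> a) (\<tau> b) \<longleftrightarrow> E a b" for a b
      using \<tau> by (auto simp: graph_auts_def)
    have \<tau>_lt: "\<tau> a < d" if "a < d" for a
      using permutes_in_image[OF perm, of a] that by simp
    define \<phi> where "\<phi> u = \<pi> (\<tau> (\<nu> u))" for u
    have "bij_betw (\<pi> \<circ> (\<tau> \<circ> \<nu>)) V V"
      using bij_betw_trans[OF bij_betw_trans[OF bij_betw_inv_into[OF \<pi>] permutes_imp_bij[OF perm]] \<pi>]
      by (simp add: \<nu>_def)
    then have "bij_betw \<phi> V V"
      by (simp add: \<phi>_def[abs_def] comp_def)
    moreover have "joined (\<phi> u) (\<phi> v) \<longleftrightarrow> joined u v" if "u \<in> V" "v \<in> V" for u v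
      using \<tau>E[OF \<nu>(1)[OF that(1)] \<nu>(1)[OF that(2)]] \<tau>_lt \<nu> that by (simp add: E_def \<phi>_def)
    ultimately obtain x where x: "x \<in> carrier G" "\<And>g i. (g, i) \<in> V \<Longrightarrow> \<phi> (g, i) = (x \<otimes> g, i)"
      using automorphism_is_translation by blast
    have "\<tau> i = \<Psi> x i" for i
    proof (cases "i < d")
      case True
      then have "\<pi> (\<tau> i) = L x (\<pi> i)"
        using x(2)[of "fst (\<pi> i)" "snd (\<pi> i)"] \<pi>V \<nu>\<pi> by (simp add: \<phi>_def L_def)
      then show ?thesis
        using \<nu>\<pi>[OF \<tau>_lt[OF True]] True by (simp add: \<Psi>_def)
    next
      case False
      then show ?thesis
        using permutes_not_in[OF perm, of i] by (simp add: \<Psi>_def)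
    qed
    then show ?thesis
      using x(1) by blast
  qed
  ultimately have "bij_betw \<Psi> (carrier G) (graph_auts d E)"
    by (auto simp: bij_betw_def)
  moreover have "\<Psi> (x \<otimes> y) = \<Psi> x \<circ> \<Psi> y" if xy: "x \<in> carrier G" "y \<in> carrier G" for x y
  proof
    fix i
    show "\<Psi> (x \<otimes> y) i = (\<Psi> x \<circ> \<Psi> y) i"
      using L_mult[OF xy, of "\<pi> i"] \<pi>V \<Psi>_lt[OF xy(2), of i] \<pi>_\<Psi>[OF xy(2), of i]
      by (simp add: \<Psi>_def)
  qed
  ultimately show ?thesis
    using graph.skeleton_rigid_graph_axioms by blast
qed

section \<open>The polytope of a finite group\<close>

theorem theorem1:
  fixes G :: "('a, 'b) monoid_scheme"
  assumes "group G" and "finite (carrier G)"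
  shows "\<exists>(d::nat) (P :: (nat \<Rightarrow> real) set). convex_polytope_in d P \<and>
    comb_aut_group P \<cong> G \<and>
    (\<forall>f\<in>comb_auts P. \<exists>g\<in>isometries_of d P. \<forall>v\<in>vertices P. f v = g v) \<and>
    (binary_polytope d P \<and> combinatorial_polytope d P) \<and>
    skeleton_diameter P \<le> 2 \<and>
    skeleton_auts P \<subseteq> comb_auts P"
proof -
  obtain d E \<Psi> where "skeleton_rigid_graph d E" and \<Psi>: "bij_betw \<Psi> (carrier G) (graph_auts d E)"
    "\<And>x y. x \<in> carrier G \<Longrightarrow> y \<in> carrier G \<Longrightarrow> \<Psi> (x \<otimes>\<^bsub>G\<^esub> y) = \<Psi> x \<circ> \<Psi> y"
    using group.ex_group_graph[OF assms] by blast
  then interpret skeleton_rigid_graph d E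
    by simp
  show ?thesis
    using convex_polytope comb_aut_group_iso[OF assms(1) \<Psi>] comb_aut_isometry binary combinatorial
      diameter skeleton_auts_subset_comb_auts
    by (intro exI[of _ d] exI[of _ P]) blast
qed

end
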